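(* There exist absolute constants $K>0$ and $\epsilon_0\in(0,1)$ such that the following holds. Let $d\ge1$, let $A$ be a finite subset of $(\mathbb{R}/\mathbb{Z})^d$ with $|A|\ge2$, and let $0<\epsilon\le\epsilon_0$. For each $a\in A$ let $N_a$ be an element of $A\setminus\{a\}$ nearest to $a$ in the norm $\|\cdot\|$. Then there exists $A'\subseteq A$ with $|A'|\ge(1-\epsilon)|A|$ such that $$|\{N_a-a: a\in A'\}|\le K\left(\tfrac43\right)^d\cdot\min_{B}\frac{|A+B|^2}{|A||B|}\cdot\frac1\epsilon\log\frac1\epsilon,$$ where the minimum is over nonempty finite subsets $B\subseteq(\mathbb{R}/\mathbb{Z})^d$.
   Context: For $t=(t_1,\dots,t_d)\in(\mathbb{R}/\mathbb{Z})^d$, $\|t\|=\min_{n\in\mathbb{Z}^d}|t-n|=\left(\sum_{i=1}^d\min_{n_i\in\mathbb{Z}}|t_i-n_i|^2\right)^{1/2}$. $A+B=\{a+b: a\in A,b\in B\}$. *)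

theory Defs
  imports Complex_Main
begin

text \<open>Points of the torus (R/Z)^d are represented by their canonical
representatives: functions x :: nat => real with 0 <= x i < 1 for i < d
and x i = 0 for i >= d.\<close>

definition torus :: "nat \<Rightarrow> (nat \<Rightarrow> real) set" where
  "torus d = {x. (\<forall>i<d. 0 \<le> x i \<and> x i < 1) \<and> (\<forall>i\<ge>d. x i = 0)}"

definition tadd :: "nat \<Rightarrow> (nat \<Rightarrow> real) \<Rightarrow> (nat \<Rightarrow> real) \<Rightarrow> (nat \<Rightarrow> real)" where
  "tadd d x y = (\<lambda>i. if i < d then frac (x i + y i) else 0)"

definition tsub :: "nat \<Rightarrow> (nat \<Rightarrow> real) \<Rightarrow> (nat \<Rightarrow> real) \<Rightarrow> (nat \<Rightarrow> real)" where
  "tsub d x y = (\<lambda>i. if i < d then frac (x i - y i) else 0)"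

definition dist_Z :: "real \<Rightarrow> real" where
  "dist_Z t = (INF n\<in>(\<int>::real set). \<bar>t - n\<bar>)"

definition tnorm :: "nat \<Rightarrow> (nat \<Rightarrow> real) \<Rightarrow> real" where
  "tnorm d t = sqrt (\<Sum>i<d. (dist_Z (t i))\<^sup>2)"

definition tsumset :: "nat \<Rightarrow> (nat \<Rightarrow> real) set \<Rightarrow> (nat \<Rightarrow> real) set \<Rightarrow> (nat \<Rightarrow> real) set" where
  "tsumset d A B = {tadd d a b | a b. a \<in> A \<and> b \<in> B}"

end

theory Submission
  imports Defs "HOL-Library.Multiset" "HOL-Analysis.Convex"
begin

text \<open>
  Give every \<open>a \<in> A\<close> the closed ball of radius \<open>\<parallel>N a - a\<parallel>\<close>. Seen from a point lying in several of these
  balls, the centres span pairwise angles of at least 60 degrees, so each point lies in at most \<open>\<kappa>\<close> of them,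
  where \<open>\<kappa> - 1\<close> bounds the kissing number. Hence, for all but \<open>\<epsilon> |A|\<close> of the \<open>a\<close>, the ball
  around \<open>a + b\<close> contains, for at least half of the \<open>b \<in> B\<close>, at most \<open>k = 2 \<kappa> |A + B| / (\<epsilon> |A|)\<close> points of
  \<open>A + B\<close>. Picking one such \<open>a\<close> for each difference, \<open>(a, b) \<mapsto> (a + b, N a + b)\<close> is injective into the
  pairs \<open>(u, v)\<close> such that \<open>v\<close> is among the \<open>k\<close> points of \<open>A + B\<close> nearest to \<open>u\<close>.

  That \<open>\<kappa>\<close> is at most a constant times \<open>(4/3) ^ d\<close> is a weak form of the Kabatiansky-Levenshtein bound
  (whose base is about 1.3205). For unit vectors with inner products at most \<open>s\<close>, let \<open>K\<close> be a polynomial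
  such that both \<open>K\<close> and \<open>(t - \<lambda>) K\<close> are nonnegative combinations of Gegenbauer
  polynomials, with \<open>\<lambda> > s\<close>. Summing \<open>(t - s) K\<^sup>2 = (t - \<lambda>) K \<cdot> K + (\<lambda> - s) K\<^sup>2\<close> over all pairs of vectors,
  only the diagonal contributes positively to the left side, the first term on the right is nonnegative
  by positive definiteness, and the second is bounded below by the squared trace over the rank of the matrix of \<open>K\<close>.
\<close>

section \<open>Zonal harmonics\<close>

text \<open>A polynomial \<open>p\<close> in countably many variables is encoded by its derivatives at the origin: the value at a
  multiset \<open>\<alpha>\<close> of variables is \<open>(\<partial>\<^sup>\<alpha> p)(0)\<close>. Differentiation is then a shift, and the Fischer
  inner product becomes \<open>\<Sum>\<alpha>. g \<alpha> * h \<alpha> / \<alpha>!\<close>.\<close>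

definition partial_deriv :: "nat \<Rightarrow> (nat multiset \<Rightarrow> real) \<Rightarrow> nat multiset \<Rightarrow> real" where
  "partial_deriv l g = (\<lambda>\<alpha>. g (add_mset l \<alpha>))"

text \<open>By the Leibniz rule, a derivative of \<open>x_l p\<close> survives at the origin only in
  the terms where exactly one of the \<open>count \<alpha> l\<close> derivatives in
  \<open>x_l\<close> falls on the factor \<open>x_l\<close>.\<close>

definition mul_var :: "nat \<Rightarrow> (nat multiset \<Rightarrow> real) \<Rightarrow> nat multiset \<Rightarrow> real" where
  "mul_var l g = (\<lambda>\<alpha>. real (count \<alpha> l) * g (\<alpha> - {#l#}))"

definition dir_deriv :: "nat \<Rightarrow> (nat \<Rightarrow> real) \<Rightarrow> (nat multiset \<Rightarrow> real) \<Rightarrow> nat multiset \<Rightarrow> real" where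
  "dir_deriv d y g = (\<lambda>\<alpha>. \<Sum>l<d. y l * partial_deriv l g \<alpha>)"

definition mul_linear :: "nat \<Rightarrow> (nat \<Rightarrow> real) \<Rightarrow> (nat multiset \<Rightarrow> real) \<Rightarrow> nat multiset \<Rightarrow> real" where
  "mul_linear d y g = (\<lambda>\<alpha>. \<Sum>l<d. y l * mul_var l g \<alpha>)"

definition laplacian :: "nat \<Rightarrow> (nat multiset \<Rightarrow> real) \<Rightarrow> nat multiset \<Rightarrow> real" where
  "laplacian d g = (\<lambda>\<alpha>. \<Sum>l<d. partial_deriv l (partial_deriv l g) \<alpha>)"

definition mul_sqnorm :: "nat \<Rightarrow> (nat multiset \<Rightarrow> real) \<Rightarrow> nat multiset \<Rightarrow> real" where
  "mul_sqnorm d g = (\<lambda>\<alpha>. \<Sum>l<d. mul_var l (mul_var l g) \<alpha>)"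

definition dot :: "nat \<Rightarrow> (nat \<Rightarrow> real) \<Rightarrow> (nat \<Rightarrow> real) \<Rightarrow> real" where
  "dot d x y = (\<Sum>l<d. x l * y l)"

section \<open>Commutation relations between differentiation and multiplication\<close>

lemma partial_deriv_mul_var:
  "partial_deriv l (mul_var m g) \<alpha> = mul_var m (partial_deriv l g) \<alpha> + (if l = m then g \<alpha> else 0)"
proof (cases "m \<in># \<alpha>")
  case True
  then obtain \<beta> where "\<alpha> = add_mset m \<beta>" by (metis insert_DiffM)
  then show ?thesis
    by (auto simp: partial_deriv_def mul_var_def algebra_simps add_mset_commute)
next
  case False
  then show ?thesis
    by (auto simp: partial_deriv_def mul_var_def not_in_iff)
qed

lemma mul_var_add: "mul_var m (\<lambda>\<alpha>. f \<alpha> + g \<alpha>) \<alpha> = mul_var m f \<alpha> + mul_var m g \<alpha>"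
  by (simp add: mul_var_def algebra_simps)

lemma mul_var_zero: "mul_var m (\<lambda>\<alpha>. 0) \<alpha> = 0"
  by (simp add: mul_var_def)

lemma partial_deriv_mul_var_sq:
  "partial_deriv l (mul_var m (mul_var m g)) \<alpha> =
     mul_var m (mul_var m (partial_deriv l g)) \<alpha> + (if l = m then 2 * mul_var m g \<alpha> else 0)"
proof -
  have "partial_deriv l (mul_var m g) =
      (\<lambda>\<alpha>. mul_var m (partial_deriv l g) \<alpha> + (if l = m then g \<alpha> else 0))"
    by (rule ext) (rule partial_deriv_mul_var)
  then show ?thesis
    by (simp add: partial_deriv_mul_var[of l m "mul_var m g"] mul_var_add mul_var_zero)
qed

lemma partial_deriv_sq_mul_var:
  "partial_deriv l (partial_deriv l (mul_var m g)) \<alpha> =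
     mul_var m (partial_deriv l (partial_deriv l g)) \<alpha> + (if l = m then 2 * partial_deriv l g \<alpha> else 0)"
proof -
  have "partial_deriv l (partial_deriv l (mul_var m g)) \<alpha> =
      partial_deriv l (mul_var m g) (add_mset l \<alpha>)"
    by (simp add: partial_deriv_def)
  also have "\<dots> = mul_var m (partial_deriv l g) (add_mset l \<alpha>) + (if l = m then g (add_mset l \<alpha>) else 0)"
    by (rule partial_deriv_mul_var)
  also have "mul_var m (partial_deriv l g) (add_mset l \<alpha>) = partial_deriv l (mul_var m (partial_deriv l g)) \<alpha>"
    by (simp add: partial_deriv_def)
  also have "\<dots> = mul_var m (partial_deriv l (partial_deriv l g)) \<alpha> + (if l = m then partial_deriv l g \<alpha> else 0)"
    by (rule partial_deriv_mul_var)
  finally show ?thesis by (simp add: partial_deriv_def)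
qed

text \<open>The commutator of the two squares is \<open>4 x_l D_l + 2\<close>, and
  \<open>x_l D_l\<close> is diagonal in this encoding, with eigenvalue
  \<open>count \<alpha> l\<close>.\<close>

lemma partial_deriv_sq_mul_var_sq:
  "partial_deriv l (partial_deriv l (mul_var m (mul_var m g))) \<alpha> =
     mul_var m (mul_var m (partial_deriv l (partial_deriv l g))) \<alpha> +
     (if l = m then (4 * real (count \<alpha> l) + 2) * g \<alpha> else 0)"
proof -
  have "partial_deriv l (mul_var m (mul_var m g)) =
     (\<lambda>\<alpha>. mul_var m (mul_var m (partial_deriv l g)) \<alpha> + (if l = m then 2 * mul_var m g \<alpha> else 0))"
    by (rule ext) (rule partial_deriv_mul_var_sq)
  then have "partial_deriv l (partial_deriv l (mul_var m (mul_var m g))) \<alpha> =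
     partial_deriv l (mul_var m (mul_var m (partial_deriv l g))) \<alpha> +
     (if l = m then 2 * partial_deriv l (mul_var m g) \<alpha> else 0)"
    by (simp add: partial_deriv_def)
  also have "\<dots> = mul_var m (mul_var m (partial_deriv l (partial_deriv l g))) \<alpha> +
     (if l = m then 2 * mul_var m (partial_deriv l g) \<alpha> else 0) +
     (if l = m then 2 * (mul_var m (partial_deriv l g) \<alpha> + g \<alpha>) else 0)"
    unfolding partial_deriv_mul_var_sq partial_deriv_mul_var by (simp add: mul_var_add mul_var_zero)
  finally have *: "partial_deriv l (partial_deriv l (mul_var m (mul_var m g))) \<alpha> = \<dots>" .
  have "mul_var l (partial_deriv l g) \<alpha> = real (count \<alpha> l) * g \<alpha>"
    by (cases "l \<in># \<alpha>") (auto simp: mul_var_def partial_deriv_def not_in_iff)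
  then show ?thesis
    unfolding * by (auto simp: algebra_simps)
qed

lemma mul_var_sum: "mul_var m (\<lambda>\<alpha>. \<Sum>l\<in>I. f l \<alpha>) \<alpha> = (\<Sum>l\<in>I. mul_var m (f l) \<alpha>)"
  by (simp add: mul_var_def sum_distrib_left)

lemma mul_var_scale: "mul_var m (\<lambda>\<alpha>. c * f \<alpha>) \<alpha> = c * mul_var m f \<alpha>"
  by (simp add: mul_var_def)

lemma dir_deriv_mul_linear:
  "dir_deriv d x (mul_linear d y g) \<alpha> = mul_linear d y (dir_deriv d x g) \<alpha> + dot d x y * g \<alpha>"
proof -
  have "dir_deriv d x (mul_linear d y g) \<alpha> =
      (\<Sum>l<d. \<Sum>m<d. x l * y m * partial_deriv l (mul_var m g) \<alpha>)"
    by (simp add: dir_deriv_def mul_linear_def partial_deriv_def sum_distrib_left mult.assoc)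
  also have "\<dots> = (\<Sum>l<d. \<Sum>m<d. x l * y m * mul_var m (partial_deriv l g) \<alpha>) +
      (\<Sum>l<d. \<Sum>m<d. if l = m then x l * y m * g \<alpha> else 0)"
    unfolding partial_deriv_mul_var distrib_left sum.distrib
    by (intro arg_cong2[where f = "(+)"] sum.cong refl) auto
  also have "(\<Sum>l<d. \<Sum>m<d. if l = m then x l * y m * g \<alpha> else 0) = dot d x y * g \<alpha>"
    by (simp add: dot_def sum_distrib_right)
  also have "(\<Sum>l<d. \<Sum>m<d. x l * y m * mul_var m (partial_deriv l g) \<alpha>) =
      mul_linear d y (dir_deriv d x g) \<alpha>"
    unfolding mul_linear_def dir_deriv_def mul_var_sum mul_var_scale sum_distrib_left
    by (subst sum.swap) (simp add: mult_ac)
  finally show ?thesis .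
qed

lemma dir_deriv_mul_sqnorm:
  "dir_deriv d x (mul_sqnorm d g) \<alpha> = mul_sqnorm d (dir_deriv d x g) \<alpha> + 2 * mul_linear d x g \<alpha>"
proof -
  have "dir_deriv d x (mul_sqnorm d g) \<alpha> =
      (\<Sum>l<d. \<Sum>m<d. x l * partial_deriv l (mul_var m (mul_var m g)) \<alpha>)"
    by (simp add: dir_deriv_def mul_sqnorm_def partial_deriv_def sum_distrib_left mult.assoc)
  also have "\<dots> = (\<Sum>l<d. \<Sum>m<d. x l * mul_var m (mul_var m (partial_deriv l g)) \<alpha>) +
      (\<Sum>l<d. \<Sum>m<d. if l = m then 2 * x l * mul_var m g \<alpha> else 0)"
    unfolding partial_deriv_mul_var_sq distrib_left sum.distrib
    by (intro arg_cong2[where f = "(+)"] sum.cong refl) auto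
  also have "(\<Sum>l<d. \<Sum>m<d. if l = m then 2 * x l * mul_var m g \<alpha> else 0) = 2 * mul_linear d x g \<alpha>"
    by (simp add: mul_linear_def sum_distrib_left mult_ac)
  also have "(\<Sum>l<d. \<Sum>m<d. x l * mul_var m (mul_var m (partial_deriv l g)) \<alpha>) =
      mul_sqnorm d (dir_deriv d x g) \<alpha>"
    unfolding mul_sqnorm_def dir_deriv_def mul_var_sum mul_var_scale
    by (subst sum.swap) simp
  finally show ?thesis .
qed

lemma laplacian_mul_linear:
  "laplacian d (mul_linear d y g) \<alpha> = mul_linear d y (laplacian d g) \<alpha> + 2 * dir_deriv d y g \<alpha>"
proof -
  have "laplacian d (mul_linear d y g) \<alpha> =
      (\<Sum>l<d. \<Sum>m<d. y m * partial_deriv l (partial_deriv l (mul_var m g)) \<alpha>)"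
    by (simp add: laplacian_def mul_linear_def partial_deriv_def)
  also have "\<dots> = (\<Sum>l<d. \<Sum>m<d. y m * mul_var m (partial_deriv l (partial_deriv l g)) \<alpha>) +
      (\<Sum>l<d. \<Sum>m<d. if l = m then 2 * y m * partial_deriv l g \<alpha> else 0)"
    unfolding partial_deriv_sq_mul_var distrib_left sum.distrib
    by (intro arg_cong2[where f = "(+)"] sum.cong refl) auto
  also have "(\<Sum>l<d. \<Sum>m<d. if l = m then 2 * y m * partial_deriv l g \<alpha> else 0) = 2 * dir_deriv d y g \<alpha>"
    by (simp add: dir_deriv_def sum_distrib_left mult_ac)
  also have "(\<Sum>l<d. \<Sum>m<d. y m * mul_var m (partial_deriv l (partial_deriv l g)) \<alpha>) =
      mul_linear d y (laplacian d g) \<alpha>"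
    unfolding mul_linear_def laplacian_def mul_var_sum sum_distrib_left
    by (subst sum.swap) simp
  finally show ?thesis .
qed

text \<open>The one-variable commutators add up to four times the degree plus \<open>2 * d\<close>:
  for homogeneous \<open>g\<close> of degree \<open>j\<close>, the counts of each contributing
  \<open>\<alpha>\<close> sum to \<open>j\<close> (Euler's identity).\<close>

lemma laplacian_mul_sqnorm:
  assumes hom: "\<And>\<alpha>. g \<alpha> \<noteq> 0 \<Longrightarrow> \<alpha> \<in> multisets_of_size {..<d} j"
  shows "laplacian d (mul_sqnorm d g) \<alpha> =
    mul_sqnorm d (laplacian d g) \<alpha> + (4 * real j + 2 * real d) * g \<alpha>"
proof -
  have "laplacian d (mul_sqnorm d g) \<alpha> =
      (\<Sum>l<d. \<Sum>m<d. partial_deriv l (partial_deriv l (mul_var m (mul_var m g))) \<alpha>)"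
    by (simp add: laplacian_def mul_sqnorm_def partial_deriv_def)
  also have "\<dots> = (\<Sum>l<d. \<Sum>m<d. mul_var m (mul_var m (partial_deriv l (partial_deriv l g))) \<alpha>) +
      (\<Sum>l<d. \<Sum>m<d. if l = m then (4 * real (count \<alpha> l) + 2) * g \<alpha> else 0)"
    unfolding partial_deriv_sq_mul_var_sq sum.distrib ..
  also have "(\<Sum>l<d. \<Sum>m<d. if l = m then (4 * real (count \<alpha> l) + 2) * g \<alpha> else 0) =
      (4 * real (\<Sum>l<d. count \<alpha> l) + 2 * real d) * g \<alpha>"
    by (simp add: sum_distrib_right[symmetric] sum.distrib sum_distrib_left[symmetric])
  also have "\<dots> = (4 * real j + 2 * real d) * g \<alpha>"
  proof (cases "g \<alpha> = 0")
    case False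
    from hom[OF this] have \<alpha>: "set_mset \<alpha> \<subseteq> {..<d}" "size \<alpha> = j"
      by (auto simp: multisets_of_size_def)
    have "(\<Sum>l<d. count \<alpha> l) = size \<alpha>"
      unfolding size_multiset_overloaded_eq
      by (rule sum.mono_neutral_right) (use \<alpha> in \<open>auto simp: not_in_iff\<close>)
    with \<alpha> show ?thesis by simp
  qed simp
  also have "(\<Sum>l<d. \<Sum>m<d. mul_var m (mul_var m (partial_deriv l (partial_deriv l g))) \<alpha>) =
      mul_sqnorm d (laplacian d g) \<alpha>"
    unfolding mul_sqnorm_def laplacian_def mul_var_sum
    by (subst sum.swap) simp
  finally show ?thesis .
qed

lemma laplacian_dir_deriv: "laplacian d (dir_deriv d x g) \<alpha> = dir_deriv d x (laplacian d g) \<alpha>"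
  unfolding laplacian_def dir_deriv_def partial_deriv_def sum_distrib_left
  by (subst sum.swap) (simp add: add_mset_commute)

lemma linear_operator_simps:
  "mul_linear d y (\<lambda>\<alpha>. c * g \<alpha>) \<alpha> = c * mul_linear d y g \<alpha>"
  "mul_sqnorm d (\<lambda>\<alpha>. c * g \<alpha>) \<alpha> = c * mul_sqnorm d g \<alpha>"
  "dir_deriv d y (\<lambda>\<alpha>. f \<alpha> - c * g \<alpha>) \<alpha> = dir_deriv d y f \<alpha> - c * dir_deriv d y g \<alpha>"
  "laplacian d (\<lambda>\<alpha>. f \<alpha> - c * g \<alpha>) \<alpha> = laplacian d f \<alpha> - c * laplacian d g \<alpha>"
  "mul_linear d y (\<lambda>\<alpha>. 0) \<alpha> = 0"
  "mul_sqnorm d (\<lambda>\<alpha>. 0) \<alpha> = 0"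
  by (simp_all add: mul_linear_def mul_sqnorm_def dir_deriv_def laplacian_def mul_var_def
      partial_deriv_def algebra_simps sum.distrib sum_subtractf sum_distrib_left)

text \<open>The coefficients of the three-term recurrence of the monic Gegenbauer polynomials with parameter
  \<open>d/2 - 1\<close>, and those in \<open>\<partial>\<^sub>y Z\<^sub>j = geg_deriv_coeff d j * Z\<^bsub>j-1\<^esub>\<close> for the zonal harmonics with pole \<open>y\<close>.\<close>

definition geg_coeff :: "nat \<Rightarrow> nat \<Rightarrow> real" where
  "geg_coeff d j = real j * (real j + real d - 3) / ((2 * real j + real d - 2) * (2 * real j + real d - 4))"

definition geg_deriv_coeff :: "nat \<Rightarrow> nat \<Rightarrow> real" where
  "geg_deriv_coeff d j = real j * (real j + real d - 3) / (2 * real j + real d - 4)"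

text \<open>The Gegenbauer recurrence made homogeneous: for unit \<open>y\<close> the polynomial is
  \<open>|x|^j G_j(<x,y>/|x|)\<close>, and the factor \<open>|x|^2\<close> restores the degree that
  the last term lacks.\<close>

fun zonal :: "nat \<Rightarrow> (nat \<Rightarrow> real) \<Rightarrow> nat \<Rightarrow> nat multiset \<Rightarrow> real" where
  "zonal d y 0 = (\<lambda>\<alpha>. if \<alpha> = {#} then 1 else 0)"
| "zonal d y (Suc 0) = mul_linear d y (zonal d y 0)"
| "zonal d y (Suc (Suc j)) =
    (\<lambda>\<alpha>. mul_linear d y (zonal d y (Suc j)) \<alpha> - geg_coeff d (Suc j) * mul_sqnorm d (zonal d y j) \<alpha>)"

fun gegenbauer :: "nat \<Rightarrow> nat \<Rightarrow> real \<Rightarrow> real" where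
  "gegenbauer d 0 t = 1"
| "gegenbauer d (Suc 0) t = t"
| "gegenbauer d (Suc (Suc j)) t = t * gegenbauer d (Suc j) t - geg_coeff d (Suc j) * gegenbauer d j t"

section \<open>Homogeneity and harmonicity of the zonal polynomials\<close>

lemma mul_linear_nonzero:
  assumes "mul_linear d y g \<alpha> \<noteq> 0"
  obtains l \<beta> where "l < d" "\<alpha> = add_mset l \<beta>" "g \<beta> \<noteq> 0"
proof -
  obtain l where l: "l < d" "y l * mul_var l g \<alpha> \<noteq> 0"
    using assms unfolding mul_linear_def by (meson lessThan_iff sum.not_neutral_contains_not_neutral)
  then have "count \<alpha> l \<noteq> 0" "g (\<alpha> - {#l#}) \<noteq> 0" by (auto simp: mul_var_def)
  then show thesis
    by (intro that[of l "\<alpha> - {#l#}"]) (use l in \<open>auto simp: insert_DiffM\<close>)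
qed

lemma mul_sqnorm_nonzero:
  assumes "mul_sqnorm d g \<alpha> \<noteq> 0"
  obtains l \<beta> where "l < d" "\<alpha> = add_mset l (add_mset l \<beta>)" "g \<beta> \<noteq> 0"
proof -
  obtain l where l: "l < d" "mul_var l (mul_var l g) \<alpha> \<noteq> 0"
    using assms unfolding mul_sqnorm_def by (meson lessThan_iff sum.not_neutral_contains_not_neutral)
  then have *: "count \<alpha> l \<noteq> 0" "count (\<alpha> - {#l#}) l \<noteq> 0" "g (\<alpha> - {#l#} - {#l#}) \<noteq> 0"
    by (auto simp: mul_var_def)
  then have "\<alpha> = add_mset l (\<alpha> - {#l#})" "\<alpha> - {#l#} = add_mset l (\<alpha> - {#l#} - {#l#})"
    by (metis count_eq_zero_iff insert_DiffM)+
  then show thesis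
    using l * that by metis
qed

lemma zonal_support: "zonal d y j \<alpha> \<noteq> 0 \<Longrightarrow> \<alpha> \<in> multisets_of_size {..<d} j"
proof (induction j arbitrary: \<alpha> rule: induct_nat_012)
  case 0
  then show ?case by (simp split: if_splits)
next
  case 1
  then have "mul_linear d y (zonal d y 0) \<alpha> \<noteq> 0" by simp
  then obtain l \<beta> where "l < d" "\<alpha> = add_mset l \<beta>" "zonal d y 0 \<beta> \<noteq> 0"
    by (rule mul_linear_nonzero)
  then show ?case by (simp add: multisets_of_size_def split: if_splits)
next
  case (ge2 j)
  then consider "mul_linear d y (zonal d y (Suc j)) \<alpha> \<noteq> 0" | "mul_sqnorm d (zonal d y j) \<alpha> \<noteq> 0"
    by fastforce
  then show ?case
  proof cases
    case 1
    then obtain l \<beta> where "l < d" "\<alpha> = add_mset l \<beta>" "zonal d y (Suc j) \<beta> \<noteq> 0"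
      by (rule mul_linear_nonzero)
    with ge2.IH(2)[of \<beta>] show ?thesis by (simp add: multisets_of_size_def)
  next
    case 2
    then obtain l \<beta> where "l < d" "\<alpha> = add_mset l (add_mset l \<beta>)" "zonal d y j \<beta> \<noteq> 0"
      by (rule mul_sqnorm_nonzero)
    with ge2.IH(1)[of \<beta>] show ?thesis by (simp add: multisets_of_size_def)
  qed
qed

text \<open>The first two identities match coefficients when the recurrence is differentiated along
  \<open>y\<close>; the third cancels the Laplacian. With \<open>d \<ge> 5\<close> the denominator
  \<open>2 * j + d - 4\<close> is positive already at \<open>j = 0\<close>.\<close>

lemma geg_deriv_coeff_rec:
  assumes "d \<ge> 5"
  shows "geg_deriv_coeff d (Suc j) - 1 = geg_deriv_coeff d j - 2 * geg_coeff d j"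
    and "geg_coeff d (Suc j) * geg_deriv_coeff d j = (geg_deriv_coeff d (Suc (Suc j)) - 1) * geg_coeff d j"
    and "geg_deriv_coeff d j = geg_coeff d j * (2 * real j + real d - 2)"
proof -
  have eq1: "geg_deriv_coeff d j = geg_coeff d j * (2 * real j + real d - 2)" for j
  proof -
    have "2 * real j + real d - 2 \<noteq> 0" using assms by linarith
    then show ?thesis by (simp add: geg_deriv_coeff_def geg_coeff_def)
  qed
  have eq2: "geg_deriv_coeff d (Suc j) - 1 = geg_coeff d j * (2 * real j + real d - 4)" for j
  proof -
    have nz: "2 * real j + real d - 4 \<noteq> 0" "2 * real j + real d - 2 \<noteq> 0"
      using assms by linarith+
    have "2 * real (Suc j) + real d - 4 = 2 * real j + real d - 2" by simp
    then show ?thesis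
      using nz by (simp add: geg_deriv_coeff_def geg_coeff_def divide_simps) (simp add: algebra_simps)
  qed
  show "geg_deriv_coeff d j = geg_coeff d j * (2 * real j + real d - 2)" by (rule eq1)
  show "geg_deriv_coeff d (Suc j) - 1 = geg_deriv_coeff d j - 2 * geg_coeff d j"
    unfolding eq1[of j] eq2 by (simp add: algebra_simps)
  show "geg_coeff d (Suc j) * geg_deriv_coeff d j = (geg_deriv_coeff d (Suc (Suc j)) - 1) * geg_coeff d j"
    unfolding eq1[of j] eq2 by (simp add: algebra_simps)
qed

text \<open>The induction uses the two preceding degrees. The cases \<open>j = 0\<close> and
  \<open>j = 1\<close> are separate because the derivative in degree 0 is zero rather than a
  multiple of an earlier polynomial.\<close>

lemma dir_deriv_zonal:
  assumes "d \<ge> 5" "dot d y y = 1"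
  shows "dir_deriv d y (zonal d y (Suc j)) = (\<lambda>\<alpha>. geg_deriv_coeff d (Suc j) * zonal d y j \<alpha>)"
proof (induction j rule: less_induct)
  case (less j)
  have dz0: "dir_deriv d y (zonal d y 0) = (\<lambda>\<alpha>. 0)"
    by (auto simp: dir_deriv_def partial_deriv_def)
  have one: "geg_deriv_coeff d (Suc 0) = 1"
    using geg_deriv_coeff_rec(1)[OF assms(1), of 0] by (simp add: geg_deriv_coeff_def geg_coeff_def)
  consider "j = 0" | "j = Suc 0" | k where "j = Suc (Suc k)"
    by (metis not0_implies_Suc)
  then show ?case
  proof cases
    case 1
    show ?thesis unfolding 1
      by (rule ext) (simp add: dir_deriv_mul_linear assms dz0 linear_operator_simps one del: zonal.simps(1))
  next
    case 2
    have IH: "dir_deriv d y (zonal d y (Suc 0)) = (\<lambda>\<alpha>. zonal d y 0 \<alpha>)"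
      using less[of 0] 2 one by simp
    have c: "geg_deriv_coeff d (Suc (Suc 0)) = 1 + 1 - 2 * geg_coeff d (Suc 0)"
      using geg_deriv_coeff_rec(1)[OF assms(1), of "Suc 0"] one by simp
    show ?thesis unfolding 2
    proof
      fix \<alpha>
      have "dir_deriv d y (zonal d y (Suc (Suc 0))) \<alpha> =
          mul_linear d y (zonal d y 0) \<alpha> + 1 * zonal d y (Suc 0) \<alpha>
            - geg_coeff d (Suc 0) * (0 + 2 * mul_linear d y (zonal d y 0) \<alpha>)"
        unfolding zonal.simps(3)[of d y 0] linear_operator_simps dir_deriv_mul_linear dir_deriv_mul_sqnorm IH dz0 assms ..
      also have "\<dots> = geg_deriv_coeff d (Suc (Suc 0)) * zonal d y (Suc 0) \<alpha>"
        unfolding c zonal.simps(2) by (simp add: algebra_simps)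
      finally show "dir_deriv d y (zonal d y (Suc (Suc 0))) \<alpha> =
          geg_deriv_coeff d (Suc (Suc 0)) * zonal d y (Suc 0) \<alpha>" .
    qed
  next
    case 3
    have IH1: "dir_deriv d y (zonal d y (Suc (Suc k))) =
        (\<lambda>\<alpha>. geg_deriv_coeff d (Suc (Suc k)) * zonal d y (Suc k) \<alpha>)"
      using less[of "Suc k"] 3 by simp
    have IH2: "dir_deriv d y (zonal d y (Suc k)) =
        (\<lambda>\<alpha>. geg_deriv_coeff d (Suc k) * zonal d y k \<alpha>)"
      using less[of k] 3 by simp
    note r1 = geg_deriv_coeff_rec(1)[OF assms(1), of "Suc (Suc k)"]
    note r2 = geg_deriv_coeff_rec(2)[OF assms(1), of "Suc k"]
    show ?thesis unfolding 3
    proof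
      fix \<alpha>
      define S where "S = mul_linear d y (zonal d y (Suc k)) \<alpha>"
      define Q where "Q = mul_sqnorm d (zonal d y k) \<alpha>"
      define Z where "Z = zonal d y (Suc (Suc k)) \<alpha>"
      have Z: "Z = S - geg_coeff d (Suc k) * Q"
        by (simp add: Z_def S_def Q_def)
      have "dir_deriv d y (zonal d y (Suc (Suc (Suc k)))) \<alpha> =
         Z + geg_deriv_coeff d (Suc (Suc k)) * S
           - geg_coeff d (Suc (Suc k)) * (geg_deriv_coeff d (Suc k) * Q + 2 * S)"
        unfolding zonal.simps(3)[of d y "Suc k"] linear_operator_simps dir_deriv_mul_linear dir_deriv_mul_sqnorm
          IH1 IH2 assms
        by (simp add: S_def Q_def Z_def)
      also have "\<dots> = Z + (geg_deriv_coeff d (Suc (Suc k)) - 2 * geg_coeff d (Suc (Suc k))) * S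
           - geg_coeff d (Suc (Suc k)) * geg_deriv_coeff d (Suc k) * Q"
        by (simp add: algebra_simps)
      \<comment> \<open>The two coefficient identities make the coefficients of \<open>S\<close> and
        \<open>Q\<close> proportional to those in \<open>Z\<close>.\<close>
      also have "\<dots> = Z + (geg_deriv_coeff d (Suc (Suc (Suc k))) - 1) * (S - geg_coeff d (Suc k) * Q)"
        unfolding r1[symmetric] r2 by (simp add: algebra_simps)
      also have "\<dots> = geg_deriv_coeff d (Suc (Suc (Suc k))) * Z"
        unfolding Z by (simp add: algebra_simps)
      finally show "dir_deriv d y (zonal d y (Suc (Suc (Suc k)))) \<alpha> =
          geg_deriv_coeff d (Suc (Suc (Suc k))) * zonal d y (Suc (Suc k)) \<alpha>"
        by (simp only: Z_def)
    qed
  qed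
qed

text \<open>The Laplacian of the recurrence leaves twice the derivative of \<open>Z_(k+1)\<close>
  along \<open>y\<close> minus \<open>geg_coeff d (k+1) * (4k + 2d) * Z_k\<close>; these agree by
  the third identity of \<open>geg_deriv_coeff_rec\<close>.\<close>

lemma laplacian_zonal:
  assumes "d \<ge> 5" "dot d y y = 1"
  shows "laplacian d (zonal d y j) = (\<lambda>\<alpha>. 0)"
proof (induction j rule: less_induct)
  case (less j)
  consider "j = 0" | "j = Suc 0" | k where "j = Suc (Suc k)"
    by (metis not0_implies_Suc)
  then show ?case
  proof cases
    case 1
    then show ?thesis by (auto simp: laplacian_def partial_deriv_def)
  next
    case 2
    have "laplacian d (zonal d y 0) = (\<lambda>\<alpha>. 0)" using less[of 0] 2 by simp
    moreover have "dir_deriv d y (zonal d y 0) = (\<lambda>\<alpha>. 0)"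
      by (auto simp: dir_deriv_def partial_deriv_def)
    ultimately show ?thesis unfolding 2 zonal.simps(2)
      by (intro ext) (simp only: laplacian_mul_linear linear_operator_simps)
  next
    case 3
    have IH: "laplacian d (zonal d y (Suc k)) = (\<lambda>\<alpha>. 0)" "laplacian d (zonal d y k) = (\<lambda>\<alpha>. 0)"
      using less 3 by auto
    show ?thesis unfolding 3
    proof
      fix \<alpha>
      have hom: "laplacian d (mul_sqnorm d (zonal d y k)) \<alpha> = (4 * real k + 2 * real d) * zonal d y k \<alpha>"
        using laplacian_mul_sqnorm[OF zonal_support] by (simp add: IH linear_operator_simps)
      show "laplacian d (zonal d y (Suc (Suc k))) \<alpha> = 0"
        using geg_deriv_coeff_rec(3)[OF assms(1), of "Suc k"]
        unfolding zonal.simps(3) linear_operator_simps laplacian_mul_linear hom IH dir_deriv_zonal[OF assms]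
        by (simp add: algebra_simps)
    qed
  qed
qed

section \<open>The Fischer inner product\<close>

definition fischer_weight :: "nat \<Rightarrow> nat multiset \<Rightarrow> real" where
  "fischer_weight d \<alpha> = 1 / (\<Prod>l<d. fact (count \<alpha> l))"

definition fischer :: "nat \<Rightarrow> nat \<Rightarrow> (nat multiset \<Rightarrow> real) \<Rightarrow> (nat multiset \<Rightarrow> real) \<Rightarrow> real" where
  "fischer d j g h = (\<Sum>\<alpha>\<in>multisets_of_size {..<d} j. fischer_weight d \<alpha> * g \<alpha> * h \<alpha>)"

lemma fischer_weight_nonneg: "fischer_weight d \<alpha> \<ge> 0"
  by (simp add: fischer_weight_def prod_nonneg)

lemma fischer_weight_add_mset:
  assumes "l < d"
  shows "fischer_weight d (add_mset l \<beta>) * (real (count \<beta> l) + 1) = fischer_weight d \<beta>"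
proof -
  have "(\<Prod>i<d. fact (count (add_mset l \<beta>) i) :: real) =
      fact (Suc (count \<beta> l)) * (\<Prod>i\<in>{..<d} - {l}. fact (count (add_mset l \<beta>) i))"
    using assms by (subst prod.remove[of _ l]) auto
  also have "(\<Prod>i\<in>{..<d} - {l}. fact (count (add_mset l \<beta>) i) :: real) = (\<Prod>i\<in>{..<d} - {l}. fact (count \<beta> i))"
    by (intro prod.cong) auto
  also have "fact (Suc (count \<beta> l)) * \<dots> = (real (count \<beta> l) + 1) * (fact (count \<beta> l) * (\<Prod>i\<in>{..<d} - {l}. fact (count \<beta> i)))"
    by (simp add: algebra_simps)
  also have "fact (count \<beta> l) * (\<Prod>i\<in>{..<d} - {l}. fact (count \<beta> i) :: real) = (\<Prod>i<d. fact (count \<beta> i))"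
    using assms by (subst (2) prod.remove[of _ l]) auto
  finally show ?thesis
    by (simp add: fischer_weight_def add_nonneg_eq_0_iff)
qed

text \<open>Only \<open>\<alpha> = add_mset l \<beta>\<close> contributes, and the factor
  \<open>count \<alpha> l\<close> of \<open>mul_var\<close> turns \<open>1/\<alpha>!\<close> into
  \<open>1/\<beta>!\<close>. Multiplication and differentiation are thus adjoint.\<close>

lemma fischer_mul_var:
  assumes "l < d"
  shows "fischer d (Suc j) (mul_var l g) h = fischer d j g (partial_deriv l h)"
proof -
  have "fischer d (Suc j) (mul_var l g) h =
      (\<Sum>\<alpha>\<in>{\<alpha> \<in> multisets_of_size {..<d} (Suc j). l \<in># \<alpha>}. fischer_weight d \<alpha> * mul_var l g \<alpha> * h \<alpha>)"
    unfolding fischer_def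
    by (rule sum.mono_neutral_right) (auto simp: mul_var_def not_in_iff finite_multisets_of_size)
  also have "\<dots> = (\<Sum>\<beta>\<in>multisets_of_size {..<d} j.
      fischer_weight d (add_mset l \<beta>) * mul_var l g (add_mset l \<beta>) * h (add_mset l \<beta>))"
    by (rule sum.reindex_bij_witness[where i = "add_mset l" and j = "\<lambda>\<alpha>. \<alpha> - {#l#}"])
      (use assms in \<open>auto simp: multisets_of_size_def size_Diff_singleton dest: in_diffD\<close>)
  also have "\<dots> = fischer d j g (partial_deriv l h)"
    unfolding fischer_def
  proof (rule sum.cong[OF refl])
    fix \<beta>
    have "fischer_weight d (add_mset l \<beta>) * mul_var l g (add_mset l \<beta>) * h (add_mset l \<beta>) =
       (fischer_weight d (add_mset l \<beta>) * (real (count \<beta> l) + 1)) * g \<beta> * h (add_mset l \<beta>)"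
      by (simp add: mul_var_def)
    then show "fischer_weight d (add_mset l \<beta>) * mul_var l g (add_mset l \<beta>) * h (add_mset l \<beta>) =
       fischer_weight d \<beta> * g \<beta> * partial_deriv l h \<beta>"
      by (simp only: fischer_weight_add_mset[OF assms] partial_deriv_def)
  qed
  finally show ?thesis .
qed

lemma fischer_sum_left: "fischer d j (\<lambda>\<alpha>. \<Sum>l\<in>I. c l * f l \<alpha>) h = (\<Sum>l\<in>I. c l * fischer d j (f l) h)"
  unfolding fischer_def sum_distrib_left sum_distrib_right
  by (subst sum.swap) (simp add: mult_ac)

lemma fischer_sum_right: "fischer d j g (\<lambda>\<alpha>. \<Sum>l\<in>I. c l * f l \<alpha>) = (\<Sum>l\<in>I. c l * fischer d j g (f l))"
  unfolding fischer_def sum_distrib_left sum_distrib_right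
  by (subst sum.swap) (simp add: mult_ac)

lemma fischer_mul_linear: "fischer d (Suc j) (mul_linear d y g) h = fischer d j g (dir_deriv d y h)"
  unfolding mul_linear_def dir_deriv_def fischer_sum_left fischer_sum_right
  by (intro sum.cong) (auto simp: fischer_mul_var)

lemma fischer_mul_sqnorm: "fischer d (Suc (Suc j)) (mul_sqnorm d g) h = fischer d j g (laplacian d h)"
proof -
  have "fischer d (Suc (Suc j)) (mul_sqnorm d g) h =
      (\<Sum>l<d. fischer d (Suc (Suc j)) (mul_var l (mul_var l g)) h)"
    using fischer_sum_left[where I = "{..<d}" and c = "\<lambda>_. 1" and f = "\<lambda>l. mul_var l (mul_var l g)"]
    by (simp add: mul_sqnorm_def)
  also have "\<dots> = (\<Sum>l<d. fischer d j g (partial_deriv l (partial_deriv l h)))"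
    by (intro sum.cong) (auto simp: fischer_mul_var)
  also have "\<dots> = fischer d j g (laplacian d h)"
    using fischer_sum_right[where I = "{..<d}" and c = "\<lambda>_. 1" and f = "\<lambda>l. partial_deriv l (partial_deriv l h)"]
    by (simp add: laplacian_def)
  finally show ?thesis .
qed

text \<open>Multiplication by the squared norm is adjoint to the Laplacian, so the correction terms
  of the zonal polynomial vanish against harmonic \<open>h\<close>. What remains is the
  \<open>j\<close>-th power of a linear form, whose adjoint is the \<open>j\<close>-fold derivative.
  Harmonicity passes to derivatives since the operators commute.\<close>

lemma fischer_zonal_harmonic:
  assumes "laplacian d h = (\<lambda>\<alpha>. 0)"
  shows "fischer d j (zonal d x j) h = (dir_deriv d x ^^ j) h {#}"
  using assms
proof (induction d x j arbitrary: h rule: zonal.induct)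
  case (1 d y)
  then show ?case by (simp add: fischer_def fischer_weight_def)
next
  case (2 d y)
  have "fischer d (Suc 0) (zonal d y (Suc 0)) h = fischer d 0 (zonal d y 0) (dir_deriv d y h)"
    by (simp only: zonal.simps(2) fischer_mul_linear)
  also have "\<dots> = dir_deriv d y h {#}"
    by (simp add: fischer_def fischer_weight_def)
  finally show ?case by simp
next
  case (3 d y j)
  have "laplacian d (dir_deriv d y h) = (\<lambda>\<alpha>. 0)"
    by (rule ext) (simp add: laplacian_dir_deriv 3, simp add: dir_deriv_def partial_deriv_def)
  then have IH: "fischer d (Suc j) (zonal d y (Suc j)) (dir_deriv d y h) =
      (dir_deriv d y ^^ Suc j) (dir_deriv d y h) {#}"
    by (rule 3)
  have "fischer d (Suc (Suc j)) (zonal d y (Suc (Suc j))) h =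
      fischer d (Suc (Suc j)) (mul_linear d y (zonal d y (Suc j))) h -
      geg_coeff d (Suc j) * fischer d (Suc (Suc j)) (mul_sqnorm d (zonal d y j)) h"
    by (simp add: fischer_def algebra_simps sum_subtractf sum_distrib_left)
  also have "\<dots> = (dir_deriv d y ^^ Suc j) (dir_deriv d y h) {#}"
    unfolding fischer_mul_linear fischer_mul_sqnorm IH 3 by (simp add: fischer_def)
  finally show ?case by (simp add: funpow_swap1)
qed

section \<open>Iterated directional derivatives and the reproducing property\<close>

lemma dir_deriv_funpow_linear:
  "(dir_deriv d x ^^ n) (\<lambda>\<alpha>. f \<alpha> - c * g \<alpha>) \<alpha> = (dir_deriv d x ^^ n) f \<alpha> - c * (dir_deriv d x ^^ n) g \<alpha>"
proof (induction n arbitrary: \<alpha>)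
  case (Suc n)
  then have "(dir_deriv d x ^^ n) (\<lambda>\<alpha>. f \<alpha> - c * g \<alpha>) =
      (\<lambda>\<alpha>. (dir_deriv d x ^^ n) f \<alpha> - c * (dir_deriv d x ^^ n) g \<alpha>)" by auto
  then show ?case by (simp add: linear_operator_simps)
qed simp

lemma dir_deriv_funpow_mul_linear:
  "(dir_deriv d x ^^ Suc n) (mul_linear d y g) \<alpha> =
    mul_linear d y ((dir_deriv d x ^^ Suc n) g) \<alpha> + (real n + 1) * dot d x y * (dir_deriv d x ^^ n) g \<alpha>"
proof (induction n arbitrary: \<alpha>)
  case 0
  then show ?case by (simp add: dir_deriv_mul_linear)
next
  case (Suc n)
  have "(dir_deriv d x ^^ Suc n) (mul_linear d y g) =
    (\<lambda>\<alpha>. mul_linear d y ((dir_deriv d x ^^ Suc n) g) \<alpha> -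
       (- (real n + 1) * dot d x y) * (dir_deriv d x ^^ n) g \<alpha>)"
    by (rule ext) (simp add: Suc algebra_simps del: funpow.simps)
  then have "(dir_deriv d x ^^ Suc (Suc n)) (mul_linear d y g) \<alpha> =
    dir_deriv d x (mul_linear d y ((dir_deriv d x ^^ Suc n) g)) \<alpha> +
       (real n + 1) * dot d x y * dir_deriv d x ((dir_deriv d x ^^ n) g) \<alpha>"
    by (simp add: linear_operator_simps) (simp add: algebra_simps)
  also have "\<dots> = mul_linear d y ((dir_deriv d x ^^ Suc (Suc n)) g) \<alpha> +
      dot d x y * (dir_deriv d x ^^ Suc n) g \<alpha> + (real n + 1) * dot d x y * (dir_deriv d x ^^ Suc n) g \<alpha>"
    by (simp add: dir_deriv_mul_linear)
  finally show ?case by (simp add: algebra_simps)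
qed

text \<open>Third derivatives of the squared norm vanish, so the Leibniz rule has three terms, with
  binomial factors \<open>1\<close>, \<open>n + 2\<close> and
  \<open>(n + 1) * (n + 2) / 2\<close>.\<close>

lemma dir_deriv_funpow_mul_sqnorm:
  "(dir_deriv d x ^^ Suc (Suc n)) (mul_sqnorm d g) \<alpha> =
    mul_sqnorm d ((dir_deriv d x ^^ Suc (Suc n)) g) \<alpha> +
    2 * (real n + 2) * mul_linear d x ((dir_deriv d x ^^ Suc n) g) \<alpha> +
    (real n + 1) * (real n + 2) * dot d x x * (dir_deriv d x ^^ n) g \<alpha>"
proof (induction n arbitrary: \<alpha>)
  case 0
  have "dir_deriv d x (mul_sqnorm d g) =
     (\<lambda>\<alpha>. mul_sqnorm d (dir_deriv d x g) \<alpha> - (- 2) * mul_linear d x g \<alpha>)"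
    by (rule ext) (simp add: dir_deriv_mul_sqnorm)
  then have "(dir_deriv d x ^^ Suc (Suc 0)) (mul_sqnorm d g) \<alpha> =
     dir_deriv d x (mul_sqnorm d (dir_deriv d x g)) \<alpha> - (- 2) * dir_deriv d x (mul_linear d x g) \<alpha>"
    by (simp only: linear_operator_simps funpow.simps o_apply id_apply)
  then show ?case
    by (simp add: dir_deriv_mul_sqnorm dir_deriv_mul_linear)
next
  case (Suc n)
  let ?D = "dir_deriv d x"
  have add: "?D (\<lambda>\<alpha>. f \<alpha> + a * g \<alpha> + b * h \<alpha>) \<alpha> = ?D f \<alpha> + a * ?D g \<alpha> + b * ?D h \<alpha>" for f g h a b
    by (simp add: dir_deriv_def partial_deriv_def algebra_simps sum.distrib sum_distrib_left)
  have "(?D ^^ Suc (Suc n)) (mul_sqnorm d g) =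
    (\<lambda>\<alpha>. mul_sqnorm d ((?D ^^ Suc (Suc n)) g) \<alpha> +
      2 * (real n + 2) * mul_linear d x ((?D ^^ Suc n) g) \<alpha> +
      (real n + 1) * (real n + 2) * dot d x x * (?D ^^ n) g \<alpha>)"
    by (rule ext) (rule Suc)
  then have "(?D ^^ Suc (Suc (Suc n))) (mul_sqnorm d g) \<alpha> =
     ?D (mul_sqnorm d ((?D ^^ Suc (Suc n)) g)) \<alpha> +
      2 * (real n + 2) * ?D (mul_linear d x ((?D ^^ Suc n) g)) \<alpha> +
      (real n + 1) * (real n + 2) * dot d x x * ?D ((?D ^^ n) g) \<alpha>"
    by (simp add: add)
  also have "\<dots> = mul_sqnorm d ((?D ^^ Suc (Suc (Suc n))) g) \<alpha>
      + 2 * mul_linear d x ((?D ^^ Suc (Suc n)) g) \<alpha>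
      + 2 * (real n + 2) * (mul_linear d x ((?D ^^ Suc (Suc n)) g) \<alpha> + dot d x x * (?D ^^ Suc n) g \<alpha>) +
      (real n + 1) * (real n + 2) * dot d x x * (?D ^^ Suc n) g \<alpha>"
    by (simp add: dir_deriv_mul_sqnorm dir_deriv_mul_linear)
  finally show ?case by (simp add: algebra_simps)
qed

text \<open>At the origin every term that still carries a variable as a factor vanishes. The
  recurrence of \<open>zonal\<close> then becomes that of \<open>gegenbauer\<close>, and the Leibniz
  factors build up \<open>fact j\<close>.\<close>

lemma dir_deriv_funpow_zonal:
  assumes "dot d x x = 1"
  shows "(dir_deriv d x ^^ j) (zonal d y j) {#} = fact j * gegenbauer d j (dot d x y)"
proof (induction j rule: induct_nat_012)
  case 0
  then show ?case by simp
next
  case 1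
  show ?case
    using dir_deriv_funpow_mul_linear[where n = 0 and g = "zonal d y 0" and \<alpha> = "{#}"]
    by (simp add: mul_linear_def mul_var_def)
next
  case (ge2 j)
  have vanish: "mul_linear d z g {#} = 0" "mul_sqnorm d g {#} = 0" for z g
    by (simp_all add: mul_linear_def mul_sqnorm_def mul_var_def)
  have "(dir_deriv d x ^^ Suc (Suc j)) (zonal d y (Suc (Suc j))) {#} =
      (real (Suc j) + 1) * dot d x y * (dir_deriv d x ^^ Suc j) (zonal d y (Suc j)) {#} -
      geg_coeff d (Suc j) * ((real j + 1) * (real j + 2) * dot d x x * (dir_deriv d x ^^ j) (zonal d y j) {#})"
    unfolding zonal.simps(3) dir_deriv_funpow_linear dir_deriv_funpow_mul_linear
      dir_deriv_funpow_mul_sqnorm vanish by simp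
  also have "\<dots> = fact (Suc (Suc j)) * gegenbauer d (Suc (Suc j)) (dot d x y)"
    unfolding ge2 assms by (simp add: algebra_simps)
  finally show ?case .
qed

text \<open>Schoenberg's theorem in explicit form: on unit vectors the Gegenbauer kernel is a Gram
  matrix whose features are the coefficients of the zonal polynomials, with nonnegative
  weights.\<close>

lemma gegenbauer_fischer:
  assumes "d \<ge> 5" "dot d x x = 1" "dot d y y = 1"
  shows "gegenbauer d j (dot d x y) = fischer d j (zonal d x j) (zonal d y j) / fact j"
  using fischer_zonal_harmonic[OF laplacian_zonal[OF assms(1,3)]] dir_deriv_funpow_zonal[OF assms(2)]
  by simp

section \<open>The linear programming bound for spherical codes\<close>

lemma sum_swap_pairs:
  "(\<Sum>x\<in>X. \<Sum>y\<in>Y. \<Sum>a\<in>S. \<Sum>b\<in>T. F x y a b) = (\<Sum>a\<in>S. \<Sum>b\<in>T. \<Sum>x\<in>X. \<Sum>y\<in>Y. F x y a b)"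
  using sum.swap[of "\<lambda>p q. F (fst p) (snd p) (fst q) (snd q)" "S \<times> T" "X \<times> Y"]
  by (simp add: sum.cartesian_product')

text \<open>The idea of the Schur product theorem: products of features are features of the product
  kernel, which turns the double sum into a weighted sum of squares.\<close>

lemma kernel_product_eq:
  fixes w :: "'a \<Rightarrow> real" and w' :: "'b \<Rightarrow> real"
  shows "(\<Sum>x\<in>X. \<Sum>y\<in>X. (\<Sum>a\<in>S. w a * f x a * f y a) * (\<Sum>b\<in>T. w' b * g x b * g y b)) =
    (\<Sum>a\<in>S. \<Sum>b\<in>T. w a * w' b * (\<Sum>x\<in>X. f x a * g x b)\<^sup>2)"
proof -
  have "(\<Sum>x\<in>X. \<Sum>y\<in>X. (\<Sum>a\<in>S. w a * f x a * f y a) * (\<Sum>b\<in>T. w' b * g x b * g y b)) =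
    (\<Sum>x\<in>X. \<Sum>y\<in>X. \<Sum>a\<in>S. \<Sum>b\<in>T. w a * w' b * ((f x a * g x b) * (f y a * g y b)))"
    by (simp add: sum_product mult_ac)
  also have "\<dots> = (\<Sum>a\<in>S. \<Sum>b\<in>T. w a * w' b * (\<Sum>x\<in>X. f x a * g x b)\<^sup>2)"
    unfolding power2_eq_square sum_product by (subst sum_swap_pairs) (simp only: sum_distrib_left)
  finally show ?thesis .
qed

text \<open>Squared trace against rank times squared Frobenius norm. Cauchy-Schwarz runs over the
  features, whose number bounds the rank; the resulting squares are the diagonal terms
  \<open>a = b\<close> of the expanded Frobenius norm.\<close>

lemma kernel_square_lower:
  fixes w :: "'a \<Rightarrow> real"
  assumes "finite S" "\<And>a. a \<in> S \<Longrightarrow> w a \<ge> 0"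
  shows "(\<Sum>x\<in>X. \<Sum>a\<in>S. w a * f x a * f x a)\<^sup>2 \<le>
    real (card S) * (\<Sum>x\<in>X. \<Sum>y\<in>X. (\<Sum>a\<in>S. w a * f x a * f y a)\<^sup>2)"
proof -
  have "(\<Sum>x\<in>X. \<Sum>a\<in>S. w a * f x a * f x a)\<^sup>2 = (\<Sum>a\<in>S. w a * (\<Sum>x\<in>X. f x a * f x a))\<^sup>2"
    by (subst sum.swap) (simp add: sum_distrib_left mult_ac)
  also have "\<dots> \<le> real (card S) * (\<Sum>a\<in>S. (w a * (\<Sum>x\<in>X. f x a * f x a))\<^sup>2)"
    using sum_squared_le_sum_of_squares[of "\<lambda>a. w a * (\<Sum>x\<in>X. f x a * f x a)" S] by (simp add: mult.commute)
  also have "(\<Sum>a\<in>S. (w a * (\<Sum>x\<in>X. f x a * f x a))\<^sup>2) \<le>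
      (\<Sum>a\<in>S. \<Sum>b\<in>S. w a * w b * (\<Sum>x\<in>X. f x a * f x b)\<^sup>2)"
  proof (rule sum_mono)
    fix a assume a: "a \<in> S"
    have "(w a * (\<Sum>x\<in>X. f x a * f x a))\<^sup>2 = w a * w a * (\<Sum>x\<in>X. f x a * f x a)\<^sup>2"
      by (simp add: power2_eq_square)
    also have "\<dots> \<le> (\<Sum>b\<in>S. w a * w b * (\<Sum>x\<in>X. f x a * f x b)\<^sup>2)"
      by (rule member_le_sum) (use a assms in auto)
    finally show "(w a * (\<Sum>x\<in>X. f x a * f x a))\<^sup>2 \<le> \<dots>" .
  qed
  also have "\<dots> = (\<Sum>x\<in>X. \<Sum>y\<in>X. (\<Sum>a\<in>S. w a * f x a * f y a)\<^sup>2)"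
    unfolding kernel_product_eq[symmetric] by (simp add: power2_eq_square)
  finally show ?thesis by (simp add: mult_left_mono)
qed

section \<open>Gegenbauer kernels and the linear programming bound\<close>

lemma geg_coeff_bounds:
  assumes "d \<ge> 5"
  shows "0 \<le> geg_coeff d j" "geg_coeff d j \<le> 1/4"
proof -
  have pos: "2 * real j + real d - 2 > 0" "2 * real j + real d - 4 > 0" "real j + real d - 3 \<ge> 0"
    using assms by linarith+
  then show "0 \<le> geg_coeff d j" by (simp add: geg_coeff_def)
  \<comment> \<open>The denominator of \<open>geg_coeff\<close> minus four times its numerator is
    exactly \<open>(d - 2) * (d - 4)\<close>.\<close>
  have "0 \<le> (real d - 2) * (real d - 4)" using assms by simp
  then have "4 * (real j * (real j + real d - 3)) \<le> (2 * real j + real d - 2) * (2 * real j + real d - 4)"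
    by (simp add: algebra_simps)
  then show "geg_coeff d j \<le> 1/4"
    using pos by (simp add: geg_coeff_def divide_le_eq)
qed

lemma gegenbauer_one_pos:
  assumes "d \<ge> 5"
  shows "gegenbauer d j 1 > 0"
proof -
  \<comment> \<open>The ratio bound reproduces itself: subtracting at most \<open>G_j / 4\<close>,
    where \<open>G_j\<close> is at most \<open>2 G_(j+1)\<close>, costs at most half of
    \<open>G_(j+1)\<close>.\<close>
  have "gegenbauer d j 1 > 0 \<and> gegenbauer d (Suc j) 1 \<ge> gegenbauer d j 1 / 2" for j
  proof (induction j)
    case (Suc j)
    then have *: "gegenbauer d (Suc j) 1 > 0" by auto
    have "geg_coeff d (Suc j) * gegenbauer d j 1 \<le> 1/4 * gegenbauer d j 1"
      by (rule mult_right_mono) (use Suc geg_coeff_bounds[OF assms] in auto)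
    then have "gegenbauer d (Suc (Suc j)) 1 \<ge> gegenbauer d (Suc j) 1 / 2"
      using Suc unfolding gegenbauer.simps(3) by linarith
    with * show ?case by blast
  qed auto
  then show ?thesis by blast
qed

lemma gegenbauer_mult:
  "t * gegenbauer d (Suc j) t = gegenbauer d (Suc (Suc j)) t + geg_coeff d (Suc j) * gegenbauer d j t"
  by simp

lemma gegenbauer_product_nonneg:
  assumes "d \<ge> 5" "\<And>x. x \<in> X \<Longrightarrow> dot d x x = 1"
  shows "0 \<le> (\<Sum>x\<in>X. \<Sum>y\<in>X. gegenbauer d i (dot d x y) * gegenbauer d j (dot d x y))"
proof -
  have rep: "gegenbauer d i (dot d x y) =
      (\<Sum>\<alpha>\<in>multisets_of_size {..<d} i. (fischer_weight d \<alpha> / fact i) * zonal d x i \<alpha> * zonal d y i \<alpha>)"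
    if "x \<in> X" "y \<in> X" for x y i
    using gegenbauer_fischer[OF assms(1) assms(2)[OF that(1)] assms(2)[OF that(2)]]
    by (simp add: fischer_def sum_divide_distrib)
  have "(\<Sum>x\<in>X. \<Sum>y\<in>X. gegenbauer d i (dot d x y) * gegenbauer d j (dot d x y)) =
     (\<Sum>x\<in>X. \<Sum>y\<in>X.
       (\<Sum>\<alpha>\<in>multisets_of_size {..<d} i. (fischer_weight d \<alpha> / fact i) * zonal d x i \<alpha> * zonal d y i \<alpha>) *
       (\<Sum>\<alpha>\<in>multisets_of_size {..<d} j. (fischer_weight d \<alpha> / fact j) * zonal d x j \<alpha> * zonal d y j \<alpha>))"
    by (intro sum.cong refl) (simp only: rep)
  also have "\<dots> \<ge> 0"
    unfolding kernel_product_eq by (intro sum_nonneg mult_nonneg_nonneg) (auto simp: fischer_weight_nonneg)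
  finally show ?thesis .
qed

text \<open>The features of all degrees in \<open>I\<close> form one index set, so the number of
  monomials of these degrees bounds the rank.\<close>

lemma gegenbauer_combination_square_lower:
  assumes "d \<ge> 5" "finite I" "\<And>x. x \<in> X \<Longrightarrow> dot d x x = 1" "\<And>i. i \<in> I \<Longrightarrow> u i \<ge> 0"
  defines "K \<equiv> \<lambda>t. \<Sum>i\<in>I. u i * gegenbauer d i t"
  shows "(real (card X) * K 1)\<^sup>2 \<le>
    real (\<Sum>i\<in>I. card (multisets_of_size {..<d} i)) * (\<Sum>x\<in>X. \<Sum>y\<in>X. (K (dot d x y))\<^sup>2)"
proof -
  define S where "S = (SIGMA i:I. multisets_of_size {..<d} i)"
  define w where "w = (\<lambda>(i, \<alpha>). u i * (fischer_weight d \<alpha> / fact i))"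
  define f where "f = (\<lambda>x (i, \<alpha>). zonal d x i \<alpha>)"
  have rep: "K (dot d x y) = (\<Sum>a\<in>S. w a * f x a * f y a)" if "x \<in> X" "y \<in> X" for x y
  proof -
    have "(\<Sum>a\<in>S. w a * f x a * f y a) = (\<Sum>i\<in>I. \<Sum>\<alpha>\<in>multisets_of_size {..<d} i. w (i, \<alpha>) * f x (i, \<alpha>) * f y (i, \<alpha>))"
      unfolding S_def by (subst sum.Sigma) (auto simp: assms finite_multisets_of_size)
    also have "\<dots> = K (dot d x y)"
      unfolding K_def gegenbauer_fischer[OF assms(1) assms(3)[OF that(1)] assms(3)[OF that(2)]]
      by (simp add: fischer_def w_def f_def sum_divide_distrib sum_distrib_left mult_ac)
    finally show ?thesis ..
  qed
  have "(real (card X) * K 1)\<^sup>2 = (\<Sum>x\<in>X. \<Sum>a\<in>S. w a * f x a * f x a)\<^sup>2"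
  proof -
    have "(\<Sum>x\<in>X. \<Sum>a\<in>S. w a * f x a * f x a) = (\<Sum>x\<in>X. K 1)"
      by (intro sum.cong refl) (metis rep assms(3))
    then show ?thesis by simp
  qed
  also have "\<dots> \<le> real (card S) * (\<Sum>x\<in>X. \<Sum>y\<in>X. (\<Sum>a\<in>S. w a * f x a * f y a)\<^sup>2)"
    by (rule kernel_square_lower)
      (auto simp: S_def w_def assms finite_multisets_of_size fischer_weight_nonneg)
  also have "(\<Sum>x\<in>X. \<Sum>y\<in>X. (\<Sum>a\<in>S. w a * f x a * f y a)\<^sup>2) = (\<Sum>x\<in>X. \<Sum>y\<in>X. (K (dot d x y))\<^sup>2)"
    by (intro sum.cong refl) (simp only: rep)
  also have "card S = (\<Sum>i\<in>I. card (multisets_of_size {..<d} i))"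
    unfolding S_def by (rule card_SigmaI) (auto simp: assms finite_multisets_of_size)
  finally show ?thesis .
qed

text \<open>The polynomial \<open>K\<close> has coefficient \<open>v i\<close> in degree
  \<open>a + i\<close>. By \<open>coeff\<close>, the Jacobi matrix of the recurrence maps
  \<open>v\<close> to at least \<open>lam * v\<close>, so \<open>(t - lam) * K\<close> again has
  nonnegative coefficients.\<close>

lemma spherical_code_lp_bound:
  fixes v :: "nat \<Rightarrow> real" and lam s :: real
  assumes d: "d \<ge> 5" and X: "finite X" "\<And>x. x \<in> X \<Longrightarrow> dot d x x = 1"
    and sep: "\<And>x y. x \<in> X \<Longrightarrow> y \<in> X \<Longrightarrow> x \<noteq> y \<Longrightarrow> dot d x y \<le> s"
    and v: "v 0 = 0" "\<And>i. i > n \<Longrightarrow> v i = 0" "\<And>i. v i \<ge> 0" "\<exists>i. v i > 0"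
    and coeff: "\<And>i. v i + v (i + 2) * geg_coeff d (a + i + 2) \<ge> lam * v (i + 1)"
    and lam: "s < lam" "s \<le> 1"
  shows "(lam - s) * real (card X) \<le> (1 - s) * real (\<Sum>i\<le>n. card (multisets_of_size {..<d} (a + i)))"
proof -
  define p where "p = (\<lambda>i. gegenbauer d (a + i))"
  define K where "K = (\<lambda>t. \<Sum>i\<le>n. v i * p i t)"
  define e where "e = (\<lambda>i. (if i = 0 then 0 else v (i - 1)) + v (Suc i) * geg_coeff d (a + Suc i) - lam * v i)"
  have e_nonneg: "e i \<ge> 0" for i
  proof (cases i)
    case 0
    then show ?thesis using v geg_coeff_bounds[OF d] by (simp add: e_def)
  next
    case (Suc k)
    then show ?thesis using coeff[of k] by (simp add: e_def)
  qed
  have mult: "(t - lam) * K t = (\<Sum>i\<le>Suc n. e i * p i t)" for t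
  proof -
    have rec: "t * p (Suc i) t = p (Suc (Suc i)) t + geg_coeff d (a + Suc i) * p i t" for i
      unfolding p_def add_Suc_right by (rule gegenbauer_mult)
    have "t * K t = (\<Sum>i\<le>Suc n. t * (v i * p i t))"
      by (simp add: K_def v sum_distrib_left)
    \<comment> \<open>As \<open>v 0 = 0\<close>, the recurrence is used only from degree
      \<open>a + 1\<close> on, so no degree below \<open>a\<close> arises, even for
      \<open>a = 0\<close>.\<close>
    also have "\<dots> = (\<Sum>i\<le>n. t * (v (Suc i) * p (Suc i) t))"
      by (subst sum.atMost_Suc_shift) (simp add: v)
    also have "\<dots> = (\<Sum>i\<le>n. v (Suc i) * p (Suc (Suc i)) t) + (\<Sum>i\<le>n. v (Suc i) * geg_coeff d (a + Suc i) * p i t)"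
      unfolding sum.distrib[symmetric]
    proof (intro sum.cong refl)
      fix i
      have "t * (v (Suc i) * p (Suc i) t) = v (Suc i) * (t * p (Suc i) t)" by simp
      then show "t * (v (Suc i) * p (Suc i) t) =
          v (Suc i) * p (Suc (Suc i)) t + v (Suc i) * geg_coeff d (a + Suc i) * p i t"
        unfolding rec by (simp add: algebra_simps)
    qed
    also have "(\<Sum>i\<le>n. v (Suc i) * geg_coeff d (a + Suc i) * p i t) =
        (\<Sum>i\<le>Suc n. v (Suc i) * geg_coeff d (a + Suc i) * p i t)"
      by (simp add: v)
    also have "(\<Sum>i\<le>n. v (Suc i) * p (Suc (Suc i)) t) = (\<Sum>i\<le>Suc n. (if i = 0 then 0 else v (i - 1)) * p i t)"
    proof -
      have "(\<Sum>i\<le>Suc n. (if i = 0 then 0 else v (i - 1)) * p i t) = (\<Sum>i\<le>n. v i * p (Suc i) t)"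
        by (subst sum.atMost_Suc_shift) simp
      also have "\<dots> = (\<Sum>i\<le>Suc n. v i * p (Suc i) t)" by (simp add: v)
      also have "\<dots> = (\<Sum>i\<le>n. v (Suc i) * p (Suc (Suc i)) t)"
        by (subst sum.atMost_Suc_shift) (simp add: v)
      finally show ?thesis ..
    qed
    finally have tK: "t * K t = (\<Sum>i\<le>Suc n. (if i = 0 then 0 else v (i - 1)) * p i t) +
        (\<Sum>i\<le>Suc n. v (Suc i) * geg_coeff d (a + Suc i) * p i t)" .
    have lK: "lam * K t = (\<Sum>i\<le>Suc n. lam * v i * p i t)"
      by (simp add: K_def v sum_distrib_left mult.assoc)
    have "(t - lam) * K t = t * K t - lam * K t" by (simp add: algebra_simps)
    also have "\<dots> = (\<Sum>i\<le>Suc n. e i * p i t)"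
      unfolding tK lK sum.distrib[symmetric] sum_subtractf[symmetric] e_def
      by (intro sum.cong refl) (simp add: algebra_simps)
    finally show ?thesis .
  qed
  let ?SS = "\<lambda>F. (\<Sum>x\<in>X. \<Sum>y\<in>X. F (dot d x y))"
  have pos: "0 \<le> ?SS (\<lambda>t. (t - lam) * (K t)\<^sup>2)"
  proof -
    have "?SS (\<lambda>t. (t - lam) * (K t)\<^sup>2) = ?SS (\<lambda>t. \<Sum>i\<le>Suc n. \<Sum>j\<le>n. e i * v j * (p i t * p j t))"
    proof (intro sum.cong refl)
      fix x y
      let ?t = "dot d x y"
      have "(?t - lam) * (K ?t)\<^sup>2 = ((?t - lam) * K ?t) * K ?t" by (simp add: power2_eq_square)
      also have "\<dots> = (\<Sum>i\<le>Suc n. \<Sum>j\<le>n. e i * v j * (p i ?t * p j ?t))"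
        unfolding mult unfolding K_def sum_product by (simp add: mult_ac)
      finally show "(?t - lam) * (K ?t)\<^sup>2 = (\<Sum>i\<le>Suc n. \<Sum>j\<le>n. e i * v j * (p i ?t * p j ?t))" .
    qed
    also have "\<dots> = (\<Sum>i\<le>Suc n. \<Sum>j\<le>n. e i * v j * ?SS (\<lambda>t. p i t * p j t))"
      unfolding sum_distrib_left by (rule sum_swap_pairs)
    also have "\<dots> \<ge> 0"
      unfolding p_def
      by (intro sum_nonneg mult_nonneg_nonneg e_nonneg v gegenbauer_product_nonneg[OF d X(2)])
    finally show ?thesis .
  qed
  have K1: "K 1 > 0"
  proof -
    obtain i where i: "v i > 0" using v by blast
    then have "i \<le> n" using v(2)[of i] by force
    have "0 < v i * p i 1" using i gegenbauer_one_pos[OF d] by (simp add: p_def)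
    also have "\<dots> \<le> K 1"
      unfolding K_def
      by (rule member_le_sum)
        (use \<open>i \<le> n\<close> v(3) less_imp_le[OF gegenbauer_one_pos[OF d]] in \<open>auto simp: p_def\<close>)
    finally show ?thesis .
  qed
  define M where "M = real (card X)"
  define D where "D = real (\<Sum>i\<le>n. card (multisets_of_size {..<d} (a + i)))"
  have D_nonneg: "D \<ge> 0" unfolding D_def by (rule of_nat_0_le_iff)
  have sq: "(M * K 1)\<^sup>2 \<le> D * ?SS (\<lambda>t. (K t)\<^sup>2)"
  proof -
    have img: "(\<Sum>i\<in>(+) a ` {..n}. v (i - a) * gegenbauer d i t) = K t" for t
      by (simp add: sum.reindex K_def p_def)
    have cards: "(\<Sum>i\<in>(+) a ` {..n}. card (multisets_of_size {..<d} i)) =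
        (\<Sum>i\<le>n. card (multisets_of_size {..<d} (a + i)))"
      by (simp add: sum.reindex)
    show ?thesis
      using gegenbauer_combination_square_lower[OF d _ X(2), of "(+) a ` {..n}" X "\<lambda>i. v (i - a)"] v(3)
      unfolding img M_def D_def cards by blast
  qed
  have upper: "?SS (\<lambda>t. (t - s) * (K t)\<^sup>2) \<le> M * ((1 - s) * (K 1)\<^sup>2)"
  proof -
    have "?SS (\<lambda>t. (t - s) * (K t)\<^sup>2) \<le> (\<Sum>x\<in>X. \<Sum>y\<in>X. if x = y then (1 - s) * (K 1)\<^sup>2 else 0)"
      by (intro sum_mono) (use X(2) sep in \<open>auto intro: mult_nonpos_nonneg\<close>)
    also have "\<dots> = M * ((1 - s) * (K 1)\<^sup>2)" using X(1) by (simp add: M_def)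
    finally show ?thesis .
  qed
  have split: "?SS (\<lambda>t. (t - s) * (K t)\<^sup>2) = ?SS (\<lambda>t. (t - lam) * (K t)\<^sup>2) + (lam - s) * ?SS (\<lambda>t. (K t)\<^sup>2)"
    unfolding sum_distrib_left sum.distrib[symmetric] by (intro sum.cong refl) (simp add: algebra_simps)
  have "(lam - s) * (M * K 1)\<^sup>2 \<le> (lam - s) * (D * ?SS (\<lambda>t. (K t)\<^sup>2))"
    by (rule mult_left_mono[OF sq]) (use lam in simp)
  also have "\<dots> = D * ((lam - s) * ?SS (\<lambda>t. (K t)\<^sup>2))" by (simp add: mult_ac)
  also have "\<dots> \<le> D * (M * ((1 - s) * (K 1)\<^sup>2))"
    by (rule mult_left_mono[OF _ D_nonneg]) (use pos upper split in linarith)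
  finally have "(lam - s) * M * M * (K 1)\<^sup>2 \<le> (1 - s) * D * M * (K 1)\<^sup>2"
    by (simp add: power2_eq_square mult_ac)
  then have "(lam - s) * M * M \<le> (1 - s) * D * M"
    by (rule mult_right_le_imp_le) (use K1 in simp)
  show ?thesis
  proof (cases "M > 0")
    case True
    with \<open>(lam - s) * M * M \<le> (1 - s) * D * M\<close> show ?thesis by (simp add: M_def D_def)
  next
    case False
    then have "M = 0" by (simp add: M_def)
    moreover have "0 \<le> (1 - s) * D" using lam D_nonneg by simp
    ultimately show ?thesis by (simp add: M_def D_def)
  qed
qed

section \<open>Numerical estimates and the kissing number\<close>

lemma card_multisets_of_size_le:
  fixes x :: real
  assumes "0 < x" "x < 1" "d \<ge> 1"
  shows "real (card (multisets_of_size {..<d} j)) \<le> (1 / x) ^ j * (1 / (1 - x)) ^ d"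
proof -
  let ?N = "d + j - 1"
  \<comment> \<open>The number of multisets is \<open>?N choose j\<close>, and one term in the
    expansion of \<open>(x + (1 - x)) ^ ?N = 1\<close> is at most 1.\<close>
  have "real (?N choose j) * x ^ j * (1 - x) ^ (?N - j) \<le>
      (\<Sum>k\<le>?N. real (?N choose k) * x ^ k * (1 - x) ^ (?N - k))"
    by (rule member_le_sum) (use assms in auto)
  also have "\<dots> = (x + (1 - x)) ^ ?N" unfolding binomial_ring ..
  also have "\<dots> = 1" by simp
  finally have "real (?N choose j) * x ^ j * (1 - x) ^ (?N - j) \<le> 1" .
  then have "real (?N choose j) \<le> 1 / (x ^ j * (1 - x) ^ (?N - j))"
    using assms by (simp add: pos_le_divide_eq mult.assoc)
  also have "\<dots> = (1 / x) ^ j * (1 / (1 - x)) ^ (d - 1)"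
    using assms by (simp add: power_divide)
  also have "\<dots> \<le> (1 / x) ^ j * (1 / (1 - x)) ^ d"
    using assms by (intro mult_left_mono power_increasing) auto
  finally show ?thesis by (simp add: card_multisets_of_size)
qed

text \<open>At \<open>j = 2 m\<close> and \<open>d = 25 m\<close> the leading terms give
  \<open>2 * 27 / 29^2\<close>, about 0.06421, just above \<open>0.253^2 = 0.064009\<close>. For
  large \<open>m\<close> this gap absorbs the window of 200 and the additive constants.\<close>

lemma geg_coeff_lower:
  assumes "m \<ge> 1000000" "j \<le> 2 * m" "2 * m \<le> j + 200"
  shows "geg_coeff (25 * m) j \<ge> (253/1000)\<^sup>2"
proof -
  define x where "x = real m"
  define y where "y = real j"
  have x: "x \<ge> 1000000" and y: "y \<le> 2 * x" "2 * x - 200 \<le> y"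
    using assms unfolding x_def y_def by linarith+
  have pos: "2 * y + 25 * x - 2 > 0" "2 * y + 25 * x - 4 > 0"
    using x y by linarith+
  have "(253/1000)\<^sup>2 * ((2 * y + 25 * x - 2) * (2 * y + 25 * x - 4)) \<le> (253/1000)\<^sup>2 * ((29 * x) * (29 * x))"
    by (intro mult_left_mono mult_mono) (use x y in auto)
  also have "\<dots> \<le> (19998/10000 * x) * (269997/10000 * x)"
    using x by (simp add: power2_eq_square)
  also have "\<dots> \<le> y * (y + 25 * x - 3)"
    by (intro mult_mono) (use x y in auto)
  finally show ?thesis
    using pos by (simp add: geg_coeff_def x_def y_def pos_le_divide_eq)
qed

text \<open>In dimension \<open>25 m\<close> the degrees run over the 200 values below \<open>2 m\<close>: the ratio \<open>2/25\<close> is large enough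
  that \<open>2 sqrt (geg_coeff d j) > 2 * 253/1000 > 503/1000 > 1/2\<close>, and small enough that the dimension of the space of
  polynomials of these degrees stays below \<open>(4/3) ^ (25 m)\<close>. The weights \<open>i (201 - i)\<close> imitate the Perron
  vector of the truncated Jacobi matrix.\<close>

lemma spherical_code_bound_25:
  assumes m: "m \<ge> 1000000"
    and X: "finite X" "\<And>x. x \<in> X \<Longrightarrow> dot (25 * m) x x = 1"
    and sep: "\<And>x y. x \<in> X \<Longrightarrow> y \<in> X \<Longrightarrow> x \<noteq> y \<Longrightarrow> dot (25 * m) x y \<le> 1/2"
  shows "real (card X) \<le> 40000 * (4/3) ^ (25 * m)"
proof -
  define d where "d = 25 * m"
  define b :: real where "b = 253/1000"
  define s where "s = (\<lambda>i. real i * real (201 - i))"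
  \<comment> \<open>The powers of \<open>1 / b\<close> symmetrize the recurrence: the condition
    becomes \<open>b * (s i + s (i + 2)) \<ge> 503/1000 * s (i + 1)\<close>. Truncated subtraction
    makes \<open>s\<close> vanish from 201 on.\<close>
  define v where "v = (\<lambda>i. (1 / b) ^ i * s i)"
  define a where "a = 2 * m - 200"
  have d: "d \<ge> 5" using m by (simp add: d_def)
  have s_nonneg: "s i \<ge> 0" for i by (simp add: s_def)
  have v_nonneg: "v i \<ge> 0" for i by (simp add: v_def s_nonneg b_def)
  have coeff: "v i + v (i + 2) * geg_coeff d (a + i + 2) \<ge> 503/1000 * v (i + 1)" for i
  proof (cases "i \<ge> 200")
    case True
    then have "v (i + 1) = 0" by (simp add: v_def s_def)
    then show ?thesis using v_nonneg geg_coeff_bounds[OF d] by simp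
  next
    case False
    have "b\<^sup>2 * v (i + 2) \<le> v (i + 2) * geg_coeff d (a + i + 2)"
    proof (cases "i \<le> 198")
      case True
      have "b\<^sup>2 \<le> geg_coeff d (a + i + 2)"
        unfolding d_def b_def by (rule geg_coeff_lower) (use m True in \<open>auto simp: a_def\<close>)
      from mult_left_mono[OF this v_nonneg[of "i + 2"]] show ?thesis
        by (simp only: mult.commute[of "b\<^sup>2"])
    next
      case F: False
      then have "v (i + 2) = 0" by (simp add: v_def s_def)
      then show ?thesis by simp
    qed
    moreover have "b\<^sup>2 * v (i + 2) = (1 / b) ^ (i + 1) * (b * s (i + 2))"
      by (simp add: v_def b_def power2_eq_square)
    moreover have "v i = (1 / b) ^ (i + 1) * (b * s i)"
      by (simp add: v_def b_def)
    moreover have "503/1000 * v (i + 1) \<le> (1 / b) ^ (i + 1) * (b * s i) + (1 / b) ^ (i + 1) * (b * s (i + 2))"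
    proof -
      define r where "r = real i"
      have r: "0 \<le> r" "r \<le> 199" using False by (auto simp: r_def)
      have s0: "s i = r * (201 - r)" using False by (simp add: s_def r_def of_nat_diff)
      have s1: "s (i + 1) = (r + 1) * (200 - r)" using False by (simp add: s_def r_def of_nat_diff)
      have s2: "s (i + 2) = (r + 2) * (199 - r)" using False by (simp add: s_def r_def of_nat_diff)
      \<comment> \<open>The second difference of \<open>s\<close> is -2, so the claim amounts to
        \<open>3/1000 * s (i + 1) \<ge> 506/1000\<close>. It follows from
        \<open>s (i + 1) = 200 + r * (199 - r)\<close>.\<close>
      have "0 \<le> r * (199 - r)" using r by simp
      then have "503/1000 * s (i + 1) \<le> b * s i + b * s (i + 2)"
        unfolding s0 s1 s2 b_def by (simp add: field_simps)
      then have "(1 / b) ^ (i + 1) * (503/1000 * s (i + 1)) \<le> (1 / b) ^ (i + 1) * (b * s i + b * s (i + 2))"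
        by (rule mult_left_mono) (simp add: b_def)
      then show ?thesis by (simp add: v_def algebra_simps)
    qed
    ultimately show ?thesis by linarith
  qed
  have lp: "(503/1000 - 1/2) * real (card X) \<le>
      (1 - 1/2) * real (\<Sum>i\<le>200. card (multisets_of_size {..<d} (a + i)))"
    by (rule spherical_code_lp_bound[where v = v and lam = "503/1000"])
      (use d X sep v_nonneg coeff in \<open>auto simp: d_def v_def s_def b_def intro!: exI[of _ 1]\<close>)
  have "real (card (multisets_of_size {..<d} (a + i))) \<le> (4/3) ^ (25 * m)" if "i \<le> 200" for i
  proof -
    \<comment> \<open>The choice \<open>2/27 = 2 m / (2 m + 25 m)\<close> minimizes the bound for
      degree \<open>2 m\<close>.\<close>
    have "real (card (multisets_of_size {..<d} (a + i))) \<le> (1 / (2/27)) ^ (a + i) * (1 / (1 - 2/27)) ^ d"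
      using d by (intro card_multisets_of_size_le) auto
    also have "\<dots> \<le> (1 / (2/27)) ^ (2 * m) * (1 / (1 - 2/27)) ^ (25 * m)"
      unfolding d_def using that m by (intro mult_right_mono power_increasing) (auto simp: a_def)
    also have "\<dots> = ((27/2)\<^sup>2 * (27/25) ^ 25) ^ m"
      by (simp add: power_mult power_mult_distrib)
    \<comment> \<open>The bases compared are about 1248 and 1329.\<close>
    also have "\<dots> \<le> ((4/3) ^ 25) ^ m"
      by (intro power_mono) (simp_all add: power_divide)
    finally show ?thesis by (simp add: power_mult)
  qed
  then have "real (\<Sum>i\<le>200. card (multisets_of_size {..<d} (a + i))) \<le> (\<Sum>i\<le>(200::nat). (4/3) ^ (25 * m))"
    unfolding of_nat_sum by (intro sum_mono) auto
  also have "\<dots> = 201 * (4/3) ^ (25 * m)" by simp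
  finally have sum_le: "real (\<Sum>i\<le>200. card (multisets_of_size {..<d} (a + i))) \<le> 201 * (4/3) ^ (25 * m)" .
  have "(503/1000 - 1/2) * real (card X) \<le> (1 - 1/2) * (201 * (4/3) ^ (25 * m))"
    by (rule order_trans[OF lp mult_left_mono[OF sum_le]]) simp
  \<comment> \<open>There are 201 degrees, and
    \<open>33500 = (1/2) * 201 / (3/1000)\<close>.\<close>
  then have "real (card X) \<le> 33500 * (4/3) ^ (25 * m)" by simp
  also have "\<dots> \<le> 40000 * (4/3) ^ (25 * m)" by (rule mult_right_mono) simp_all
  finally show ?thesis .
qed

lemma dot_extend:
  assumes "\<And>i. i \<ge> d \<Longrightarrow> x i = 0" "d \<le> e"
  shows "dot e x y = dot d x y"
  unfolding dot_def by (rule sum.mono_neutral_right) (use assms in auto)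

text \<open>Vectors are padded with zeros to dimension \<open>25 * m\<close> with \<open>m\<close>
  large. Since \<open>25 * m \<le> 25 * M + 25 + d\<close>, this costs only a constant
  factor.\<close>

theorem kissing_number_bound:
  obtains C :: real where "C > 0"
    "\<And>d X. \<lbrakk>finite X; \<And>x i. x \<in> X \<Longrightarrow> i \<ge> d \<Longrightarrow> x i = 0; \<And>x. x \<in> X \<Longrightarrow> dot d x x = 1;
       \<And>x y. x \<in> X \<Longrightarrow> y \<in> X \<Longrightarrow> x \<noteq> y \<Longrightarrow> dot d x y \<le> 1/2\<rbrakk>
      \<Longrightarrow> real (card X) \<le> C * (4/3) ^ d"
proof -
  obtain M :: nat where M: "M \<ge> 1000000" by blast
  show thesis
  proof (rule that[of "40000 * (4/3) ^ (25 * M + 25)"])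
    fix d :: nat and X :: "(nat \<Rightarrow> real) set"
    assume X: "finite X" "\<And>x i. x \<in> X \<Longrightarrow> i \<ge> d \<Longrightarrow> x i = 0" "\<And>x. x \<in> X \<Longrightarrow> dot d x x = 1"
      "\<And>x y. x \<in> X \<Longrightarrow> y \<in> X \<Longrightarrow> x \<noteq> y \<Longrightarrow> dot d x y \<le> 1/2"
    define m where "m = M + d div 25 + 1"
    have "d \<le> 25 * m" by (simp add: m_def)
    then have ext: "dot (25 * m) x y = dot d x y" if "x \<in> X" for x y
      by (intro dot_extend) (use X(2)[OF that] in auto)
    have "real (card X) \<le> 40000 * (4/3) ^ (25 * m)"
      by (rule spherical_code_bound_25) (use X M ext in \<open>auto simp: m_def\<close>)
    also have "\<dots> \<le> 40000 * (4/3) ^ (25 * M + 25 + d)"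
      by (intro mult_left_mono power_increasing) (auto simp: m_def)
    finally show "real (card X) \<le> 40000 * (4/3) ^ (25 * M + 25) * (4/3) ^ d"
      by (simp add: power_add)
  qed simp
qed

section \<open>Nearest neighbours in the torus\<close>

lemma dist_Z_eq: "dist_Z t = \<bar>t - of_int (round t)\<bar>"
  unfolding dist_Z_def
proof (rule cInf_eq_minimum)
  show "\<bar>t - of_int (round t)\<bar> \<in> (\<lambda>n. \<bar>t - n\<bar>) ` \<int>" by auto
  fix x assume "x \<in> (\<lambda>n. \<bar>t - n\<bar>) ` \<int>"
  then obtain k :: int where "x = \<bar>t - of_int k\<bar>" by (auto elim!: Ints_cases)
  then show "\<bar>t - of_int (round t)\<bar> \<le> x" using round_diff_minimal[of t k] by simp
qed

lemma dist_Z_le: "t - u \<in> \<int> \<Longrightarrow> dist_Z t \<le> \<bar>u\<bar>"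
proof -
  assume "t - u \<in> \<int>"
  then obtain k :: int where "t - u = of_int k" by (auto elim!: Ints_cases)
  then have "u = t - of_int k" by simp
  then show ?thesis using round_diff_minimal[of t k] by (simp add: dist_Z_eq)
qed

lemma dist_Z_nonneg: "0 \<le> dist_Z t"
  by (simp add: dist_Z_eq)

lemma dist_Z_cong: "t - u \<in> \<int> \<Longrightarrow> dist_Z t = dist_Z u"
proof -
  have *: "dist_Z t \<le> dist_Z u" if "t - u \<in> \<int>" for t u
    unfolding dist_Z_eq[of u]
  proof (rule dist_Z_le)
    have "t - (u - of_int (round u)) = (t - u) + of_int (round u)" by simp
    then show "t - (u - of_int (round u)) \<in> \<int>" using that by (metis Ints_add Ints_of_int)
  qed
  assume "t - u \<in> \<int>"
  moreover from this have "u - t \<in> \<int>" by (metis Ints_minus minus_diff_eq)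
  ultimately show ?thesis using * by (metis order_antisym)
qed

lemma dist_Z_minus: "dist_Z (- t) = dist_Z t"
proof -
  have *: "dist_Z (- t) \<le> dist_Z t" for t
    using dist_Z_le[of "- t" "- (t - of_int (round t))"] by (simp add: dist_Z_eq[of t] abs_minus_commute)
  from *[of t] *[of "- t"] show ?thesis by simp
qed

lemma frac_diff_Ints: "frac (x::real) - x \<in> \<int>"
  by (simp add: frac_def)

lemma tnorm_cong:
  assumes "\<And>i. i < d \<Longrightarrow> s i - t i \<in> \<int>"
  shows "tnorm d s = tnorm d t"
  unfolding tnorm_def
  by (intro arg_cong[where f = sqrt] sum.cong refl) (simp add: dist_Z_cong[OF assms])

lemma tnorm_tsub: "tnorm d (tsub d x y) = tnorm d (\<lambda>i. x i - y i)"
  by (rule tnorm_cong) (simp add: tsub_def frac_diff_Ints)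

lemma tnorm_tsub_commute: "tnorm d (tsub d x y) = tnorm d (tsub d y x)"
proof -
  have "dist_Z (x i - y i) = dist_Z (y i - x i)" for i
    using dist_Z_minus[of "x i - y i"] by simp
  then show ?thesis unfolding tnorm_tsub by (simp add: tnorm_def)
qed

lemma tnorm_nonneg: "0 \<le> tnorm d t"
  by (simp add: tnorm_def sum_nonneg)

lemma frac_eq_iff_Ints: "frac (x::real) = frac y \<longleftrightarrow> x - y \<in> \<int>"
proof
  assume "frac x = frac y"
  then have "x - y = of_int (\<lfloor>x\<rfloor> - \<lfloor>y\<rfloor>)" by (simp add: frac_def)
  then show "x - y \<in> \<int>" by (metis Ints_of_int)
next
  assume "x - y \<in> \<int>"
  then obtain k where "x = y + of_int k" by (auto elim!: Ints_cases simp: algebra_simps)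
  then show "frac x = frac y" by (simp add: frac_def)
qed

lemma torus_eqI:
  assumes "x \<in> torus d" "y \<in> torus d" "\<And>i. i < d \<Longrightarrow> x i - y i \<in> \<int>"
  shows "x = y"
proof
  fix i
  show "x i = y i"
  proof (cases "i < d")
    case True
    then have "frac (x i) = frac (y i)" using assms(3) by (simp add: frac_eq_iff_Ints)
    then show ?thesis using True assms(1,2) by (simp add: torus_def frac_eq)
  qed (use assms(1,2) in \<open>auto simp: torus_def\<close>)
qed

lemma tsub_in_torus: "tsub d x y \<in> torus d"
  by (auto simp: torus_def tsub_def frac_ge_0 frac_lt_1)

lemma tnorm_tsub_eq_0:
  assumes "x \<in> torus d" "y \<in> torus d" "tnorm d (tsub d x y) = 0"
  shows "x = y"
proof (rule torus_eqI[OF assms(1,2)])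
  fix i assume "i < d"
  from assms(3) have "(\<Sum>i<d. (dist_Z (x i - y i))\<^sup>2) = 0"
    unfolding tnorm_tsub by (simp add: tnorm_def)
  then have "dist_Z (x i - y i) = 0"
    using \<open>i < d\<close> by (simp add: sum_nonneg_eq_0_iff)
  then have "x i - y i = of_int (round (x i - y i))" by (simp add: dist_Z_eq)
  then show "x i - y i \<in> \<int>" by (metis Ints_of_int)
qed

lemma tsub_tadd_cancel: "tsub d (tadd d x b) (tadd d y b) = tsub d x y"
proof -
  have "frac (frac (u + c) - frac (w + c)) = frac (u - w)" for u w c :: real
  proof -
    have "(frac (u + c) - frac (w + c)) - (u - w) = of_int (\<lfloor>w + c\<rfloor> - \<lfloor>u + c\<rfloor>)"
      by (simp add: frac_def)
    then show ?thesis by (metis Ints_of_int frac_eq_iff_Ints)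
  qed
  then show ?thesis by (auto simp: tsub_def tadd_def)
qed

lemma tadd_left_cancel:
  assumes "b \<in> torus d" "c \<in> torus d" "tadd d x b = tadd d x c"
  shows "b = c"
proof (rule torus_eqI[OF assms(1,2)])
  fix i assume "i < d"
  then have "frac (x i + b i) = frac (x i + c i)"
    using assms(3) by (simp add: tadd_def fun_eq_iff split: if_splits)
  then show "b i - c i \<in> \<int>" by (simp add: frac_eq_iff_Ints)
qed

section \<open>Overlap of nearest-neighbour balls\<close>

lemma nearest_ball_overlap:
  assumes kiss: "\<And>X. \<lbrakk>finite X; \<And>x i. x \<in> X \<Longrightarrow> i \<ge> d \<Longrightarrow> x i = 0; \<And>x. x \<in> X \<Longrightarrow> dot d x x = 1;
       \<And>x y. x \<in> X \<Longrightarrow> y \<in> X \<Longrightarrow> x \<noteq> y \<Longrightarrow> dot d x y \<le> 1/2\<rbrakk> \<Longrightarrow> real (card X) \<le> \<kappa>"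
    and A: "finite A" "A \<subseteq> torus d" and x: "x \<in> torus d"
    and ball: "\<And>a. a \<in> A \<Longrightarrow> tnorm d (tsub d a x) \<le> r a"
    and sep: "\<And>a b. a \<in> A \<Longrightarrow> b \<in> A \<Longrightarrow> a \<noteq> b \<Longrightarrow> r a \<le> tnorm d (tsub d b a)"
  shows "real (card A) \<le> \<kappa> + 1"
proof -
  \<comment> \<open>This is a shortest real vector representing \<open>a - x\<close>, with
    coordinates in \<open>[-1/2, 1/2]\<close>.\<close>
  define w where "w = (\<lambda>a i. if i < d then (a i - x i) - of_int (round (a i - x i)) else 0 :: real)"
  define N where "N = (\<lambda>a. sqrt (dot d (w a) (w a)))"
  define u where "u = (\<lambda>a i. w a i / N a)"
  define B where "B = A - {x}"
  have dot_nonneg: "0 \<le> dot d y y" for y by (simp add: dot_def sum_nonneg)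
  have N_sq: "N a ^ 2 = dot d (w a) (w a)" for a by (simp add: N_def dot_nonneg)
  have N: "N a = tnorm d (tsub d a x)" for a
    unfolding tnorm_tsub by (simp add: N_def tnorm_def dot_def w_def dist_Z_eq power2_eq_square)
  have N_pos: "N a > 0" if "a \<in> B" for a
  proof -
    from that have "a \<in> torus d" "a \<noteq> x" using A by (auto simp: B_def)
    then have "N a \<noteq> 0" using tnorm_tsub_eq_0[of a d x] x unfolding N by blast
    then show ?thesis using tnorm_nonneg[of d "tsub d a x"] unfolding N by linarith
  qed
  \<comment> \<open>The vector \<open>w b - w a\<close> represents \<open>b - a\<close> but need not
    be shortest, so the torus distance is at most its length, which the law of cosines
    computes.\<close>
  have far: "tnorm d (tsub d b a) ^ 2 \<le> N a ^ 2 + N b ^ 2 - 2 * dot d (w a) (w b)" for a b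
  proof -
    have "tnorm d (tsub d b a) ^ 2 = (\<Sum>i<d. (dist_Z (b i - a i))\<^sup>2)"
      unfolding tnorm_tsub by (simp add: tnorm_def sum_nonneg)
    also have "\<dots> \<le> (\<Sum>i<d. (w b i - w a i)\<^sup>2)"
    proof (rule sum_mono)
      fix i assume "i \<in> {..<d}"
      then have "(b i - a i) - (w b i - w a i) = of_int (round (b i - x i) - round (a i - x i))"
        by (simp add: w_def)
      then have "dist_Z (b i - a i) \<le> \<bar>w b i - w a i\<bar>"
        by (intro dist_Z_le) (metis Ints_of_int)
      then show "(dist_Z (b i - a i))\<^sup>2 \<le> (w b i - w a i)\<^sup>2"
        using dist_Z_nonneg by (metis power2_abs power_mono)
    qed
    also have "\<dots> = N a ^ 2 + N b ^ 2 - 2 * dot d (w a) (w b)"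
      unfolding N_sq dot_def sum_distrib_left sum.distrib[symmetric] sum_subtractf[symmetric]
      by (intro sum.cong refl) (simp add: power2_eq_square algebra_simps)
    finally show ?thesis .
  qed
  \<comment> \<open>In the triangle spanned by \<open>w a\<close> and \<open>w b\<close>, the side
    opposite \<open>x\<close> is at least as long as the other two, so the angle at \<open>x\<close>
    is at least 60 degrees. In formulas, the smaller of \<open>N a ^ 2\<close> and
    \<open>N b ^ 2\<close> is at most \<open>N a * N b\<close>.\<close>
  have angle: "2 * dot d (w a) (w b) \<le> N a * N b" if "a \<in> B" "b \<in> B" "a \<noteq> b" for a b
  proof -
    have ab: "a \<in> A" "b \<in> A" "b \<noteq> a" using that by (auto simp: B_def)
    have pos: "0 \<le> N a" "0 \<le> N b" using N_pos that by (auto intro: less_imp_le)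
    have "N a \<le> tnorm d (tsub d b a)"
      using order_trans[OF ball[OF ab(1)] sep[OF ab(1,2) that(3)]] unfolding N .
    moreover have "N b \<le> tnorm d (tsub d b a)"
      using order_trans[OF ball[OF ab(2)] sep[OF ab(2,1,3)]] unfolding N tnorm_tsub_commute[of d b a] .
    ultimately have "N a ^ 2 \<le> tnorm d (tsub d b a) ^ 2" "N b ^ 2 \<le> tnorm d (tsub d b a) ^ 2"
      using pos by (auto intro: power_mono)
    with far[of b a] have "2 * dot d (w a) (w b) \<le> N a ^ 2" "2 * dot d (w a) (w b) \<le> N b ^ 2"
      by linarith+
    moreover have "N a ^ 2 \<le> N a * N b \<or> N b ^ 2 \<le> N a * N b"
      using pos by (cases "N a \<le> N b") (auto simp: power2_eq_square intro: mult_left_mono mult_right_mono)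
    ultimately show ?thesis by linarith
  qed
  have dot_u: "dot d (u a) (u b) = dot d (w a) (w b) / (N a * N b)" for a b
    by (simp add: dot_def u_def sum_divide_distrib)
  have unit: "dot d (u a) (u a) = 1" if "a \<in> B" for a
    using N_pos[OF that] by (simp add: dot_u N_sq[symmetric] power2_eq_square)
  have half: "dot d (u a) (u b) \<le> 1/2" if "a \<in> B" "b \<in> B" "a \<noteq> b" for a b
    using angle[OF that] N_pos that by (simp add: dot_u divide_le_eq)
  \<comment> \<open>Equal directions would have inner product 1, above 1/2, so normalizing
    identifies no two points.\<close>
  have inj: "inj_on u B"
  proof (rule inj_onI, rule ccontr)
    fix a b assume "a \<in> B" "b \<in> B" "u a = u b" "a \<noteq> b"
    with half[of a b] unit[of a] show False by simp
  qed
  have "real (card (u ` B)) \<le> \<kappa>"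
  proof (rule kiss)
    show "finite (u ` B)" using A by (simp add: B_def)
    show "y i = 0" if "y \<in> u ` B" "i \<ge> d" for y i using that by (auto simp: u_def w_def)
    show "dot d y y = 1" if "y \<in> u ` B" for y using that unit by auto
    show "dot d y z \<le> 1/2" if "y \<in> u ` B" "z \<in> u ` B" "y \<noteq> z" for y z using that half by auto
  qed
  then have "real (card B) \<le> \<kappa>" by (simp add: card_image[OF inj])
  \<comment> \<open>The extra 1 accounts for \<open>x\<close> itself, which has no
    direction.\<close>
  moreover have "card A \<le> card B + 1"
    unfolding B_def using card_Suc_Diff1[OF A(1), of x] by (cases "x \<in> A") (linarith, simp)
  ultimately show ?thesis by linarith
qed

section \<open>Counting pairs of near points in the sumset\<close>

lemma tadd_commute: "tadd d x y = tadd d y x"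
  by (auto simp: tadd_def add.commute)

text \<open>For fixed \<open>b\<close>, this turns balls around \<open>a + b\<close> containing
  \<open>u\<close> into balls around \<open>a\<close> containing \<open>u - b\<close>, to which the
  overlap bound applies.\<close>

lemma tnorm_tsub_tadd: "tnorm d (tsub d u (tadd d a b)) = tnorm d (tsub d a (tsub d u b))"
proof -
  have "tnorm d (tsub d u (tadd d a b)) = tnorm d (tsub d (tadd d a b) u)"
    by (rule tnorm_tsub_commute)
  also have "\<dots> = tnorm d (tsub d a (tsub d u b))"
    unfolding tnorm_tsub
  proof (rule tnorm_cong)
    fix i assume "i < d"
    then have "(tadd d a b i - u i) - (a i - tsub d u b i) = of_int (- \<lfloor>a i + b i\<rfloor> - \<lfloor>u i - b i\<rfloor>)"
      by (simp add: tadd_def tsub_def frac_def)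
    then show "(tadd d a b i - u i) - (a i - tsub d u b i) \<in> \<int>" by (metis Ints_of_int)
  qed
  finally show ?thesis .
qed

text \<open>Markov's inequality, applied first over \<open>A\<close> and then over
  \<open>B\<close>.\<close>

lemma card_exceeding_le:
  fixes f :: "'a \<Rightarrow> real"
  assumes "finite A" "\<And>a. a \<in> A \<Longrightarrow> 0 \<le> f a" "sum f A \<le> M"
  shows "real (card {a \<in> A. f a > T}) * T \<le> M"
proof -
  have "real (card {a \<in> A. f a > T}) * T \<le> sum f {a \<in> A. f a > T}"
    using sum_bounded_below[of "{a \<in> A. f a > T}" T f] by auto
  also have "\<dots> \<le> sum f A" by (rule sum_mono2) (use assms in auto)
  finally show ?thesis using assms(3) by linarith
qed

text \<open>The condition on a member with maximal \<open>g\<close> already counts all members.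
  Counting with a weak inequality takes care of ties.\<close>

lemma card_few_closer_le:
  fixes g :: "'a \<Rightarrow> real"
  assumes "finite S" "0 \<le> k"
  shows "real (card {v \<in> S. real (card {z \<in> S. g z \<le> g v}) \<le> k}) \<le> k"
proof (cases "{v \<in> S. real (card {z \<in> S. g z \<le> g v}) \<le> k} = {}")
  case True
  show ?thesis unfolding True using assms by simp
next
  case False
  let ?V = "{v \<in> S. real (card {z \<in> S. g z \<le> g v}) \<le> k}"
  have fin: "finite ?V" using assms by simp
  obtain m where m: "m \<in> ?V" "\<And>v. v \<in> ?V \<Longrightarrow> g v \<le> g m"
    using Max_in[of "g ` ?V"] Max_ge[of "g ` ?V"] fin False by fastforce
  have "card ?V \<le> card {z \<in> S. g z \<le> g m}"
    by (rule card_mono) (use m assms in auto)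
  then show ?thesis using m(1) by simp
qed

lemma tsumset_finite: "finite A \<Longrightarrow> finite B \<Longrightarrow> finite (tsumset d A B)"
  unfolding tsumset_def by (rule finite_image_set2) auto

lemma few_nearest_differences:
  assumes A: "A \<subseteq> torus d" "finite A" "A \<noteq> {}" and \<epsilon>: "0 < \<epsilon>"
    and N: "\<And>a. a \<in> A \<Longrightarrow> N a \<in> A"
    and near: "\<And>a b. a \<in> A \<Longrightarrow> b \<in> A \<Longrightarrow> b \<noteq> a \<Longrightarrow> tnorm d (tsub d (N a) a) \<le> tnorm d (tsub d b a)"
    and B: "B \<subseteq> torus d" "finite B" "B \<noteq> {}"
    and overlap: "\<And>x A'. \<lbrakk>A' \<subseteq> A; x \<in> torus d;
        \<And>a. a \<in> A' \<Longrightarrow> tnorm d (tsub d a x) \<le> tnorm d (tsub d (N a) a)\<rbrakk> \<Longrightarrow> real (card A') \<le> \<kappa>"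
    and \<kappa>: "\<kappa> > 0"
  shows "\<exists>A'\<subseteq>A. real (card A') \<ge> (1 - \<epsilon>) * real (card A) \<and>
    real (card ((\<lambda>a. tsub d (N a) a) ` A')) \<le>
      4 * \<kappa> / \<epsilon> * (real (card (tsumset d A B)) ^ 2 / (real (card A) * real (card B)))"
proof -
  define S where "S = tsumset d A B"
  define r where "r = (\<lambda>a. tnorm d (tsub d (N a) a))"
  \<comment> \<open>As \<open>N a + b\<close> lies on the boundary of this ball,
    \<open>c a b\<close> is its rank by distance from \<open>a + b\<close>, ties included.\<close>
  define c where "c = (\<lambda>a b. real (card {u \<in> S. tnorm d (tsub d u (tadd d a b)) \<le> r a}))"
  define n where "n = real (card A)"
  define \<beta> where "\<beta> = real (card B)"
  define s where "s = real (card S)"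
  \<comment> \<open>With total count at most \<open>\<beta> * (s * \<kappa>)\<close>, this is the
    threshold at which Markov's inequality discards at most \<open>\<epsilon> * n\<close>
    elements.\<close>
  define T where "T = \<beta> * (s * \<kappa>) / (\<epsilon> * n)"
  define A' where "A' = A - {a \<in> A. (\<Sum>b\<in>B. c a b) > T}"
  have finS: "finite S" unfolding S_def using A B by (simp add: tsumset_finite)
  have in_S: "tadd d a b \<in> S" if "a \<in> A" "b \<in> B" for a b
    using that by (auto simp: S_def tsumset_def)
  have "S \<noteq> {}" using A(3) B(3) in_S by blast
  have pos: "n > 0" "\<beta> > 0" "s > 0"
    using A B finS \<open>S \<noteq> {}\<close> by (auto simp: n_def \<beta>_def s_def card_gt_0_iff)
  have T: "T > 0" using pos \<epsilon> \<kappa> by (simp add: T_def)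
  have c_nonneg: "c a b \<ge> 0" for a b by (simp add: c_def)
  have "(\<Sum>a\<in>A. c a b) \<le> s * \<kappa>" if "b \<in> B" for b
  proof -
    have "(\<Sum>a\<in>A. c a b) = (\<Sum>a\<in>A. \<Sum>u\<in>S. if tnorm d (tsub d u (tadd d a b)) \<le> r a then 1 else 0)"
      unfolding c_def using finS by (intro sum.cong refl) (simp flip: sum.inter_filter)
    also have "\<dots> = (\<Sum>u\<in>S. \<Sum>a\<in>A. if tnorm d (tsub d u (tadd d a b)) \<le> r a then 1 else 0)"
      by (rule sum.swap)
    also have "\<dots> = (\<Sum>u\<in>S. real (card {a \<in> A. tnorm d (tsub d a (tsub d u b)) \<le> r a}))"
      using A by (intro sum.cong refl) (simp add: tnorm_tsub_tadd flip: sum.inter_filter)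
    also have "\<dots> \<le> (\<Sum>u\<in>S. \<kappa>)"
      by (intro sum_mono overlap) (auto simp: r_def tsub_in_torus)
    finally show ?thesis by (simp add: s_def)
  qed
  then have "(\<Sum>b\<in>B. \<Sum>a\<in>A. c a b) \<le> (\<Sum>b\<in>B. s * \<kappa>)" by (intro sum_mono)
  then have total: "(\<Sum>a\<in>A. \<Sum>b\<in>B. c a b) \<le> \<beta> * (s * \<kappa>)"
    by (subst sum.swap) (simp add: \<beta>_def)
  have "real (card {a \<in> A. (\<Sum>b\<in>B. c a b) > T}) * T \<le> \<beta> * (s * \<kappa>)"
    by (rule card_exceeding_le) (use A total c_nonneg in \<open>auto intro: sum_nonneg\<close>)
  also have "\<dots> = \<epsilon> * n * T" using pos \<epsilon> by (simp add: T_def)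
  finally have "real (card {a \<in> A. (\<Sum>b\<in>B. c a b) > T}) \<le> \<epsilon> * n"
    using T by simp
  moreover have "card A' = card A - card {a \<in> A. (\<Sum>b\<in>B. c a b) > T}"
    unfolding A'_def by (rule card_Diff_subset) (use A in auto)
  moreover have "card {a \<in> A. (\<Sum>b\<in>B. c a b) > T} \<le> card A"
    by (rule card_mono) (use A in auto)
  ultimately have A'_card: "real (card A') \<ge> (1 - \<epsilon>) * real (card A)"
    by (simp add: n_def algebra_simps of_nat_diff)
  define D where "D = (\<lambda>a. tsub d (N a) a) ` A'"
  \<comment> \<open>Keeping one representative per difference is what makes the pair map below
    injective.\<close>
  define h where "h = inv_into A' (\<lambda>a. tsub d (N a) a)"
  have h: "h \<delta> \<in> A'" "tsub d (N (h \<delta>)) (h \<delta>) = \<delta>" if "\<delta> \<in> D" for \<delta>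
    using that inv_into_into[of \<delta> "\<lambda>a. tsub d (N a) a" A'] f_inv_into_f[of \<delta> "\<lambda>a. tsub d (N a) a" A']
    unfolding D_def h_def by auto
  have A'_sub: "A' \<subseteq> A" by (auto simp: A'_def)
  have finD: "finite D" using A A'_sub by (auto simp: D_def intro: finite_subset)
  \<comment> \<open>Twice the permitted average over \<open>B\<close>, so that at least half of
    \<open>B\<close> stays below it.\<close>
  define k where "k = 2 * T / \<beta>"
  define P where "P = (SIGMA \<delta>:D. {b \<in> B. c (h \<delta>) b \<le> k})"
  define V where "V = (\<lambda>u. {v \<in> S. real (card {z \<in> S. tnorm d (tsub d z u) \<le> tnorm d (tsub d v u)}) \<le> k})"
  have many: "real (card {b \<in> B. c a b \<le> k}) \<ge> \<beta> / 2" if "a \<in> A'" for a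
  proof -
    have "real (card {b \<in> B. c a b > k}) * k \<le> T"
      by (rule card_exceeding_le) (use that B c_nonneg in \<open>auto simp: A'_def\<close>)
    also have "T = \<beta> / 2 * k" using pos by (simp add: k_def)
    finally have "real (card {b \<in> B. c a b > k}) \<le> \<beta> / 2"
      by (rule mult_right_le_imp_le) (use T pos in \<open>simp add: k_def\<close>)
    moreover have "card B = card {b \<in> B. c a b \<le> k} + card {b \<in> B. c a b > k}"
      using B by (subst card_Un_disjoint[symmetric]) (auto intro!: arg_cong[where f = card])
    ultimately show ?thesis by (simp add: \<beta>_def)
  qed
  have "real (card D) * (\<beta> / 2) = (\<Sum>\<delta>\<in>D. \<beta> / 2)" by simp
  also have "\<dots> \<le> (\<Sum>\<delta>\<in>D. real (card {b \<in> B. c (h \<delta>) b \<le> k}))"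
    by (intro sum_mono many h)
  also have "\<dots> = real (card P)"
    unfolding P_def using finD B by (subst card_SigmaI) auto
  also have "card P \<le> card (SIGMA u:S. V u)"
  proof (rule card_inj_on_le)
    let ?\<phi> = "\<lambda>(\<delta>, b). (tadd d (h \<delta>) b, tadd d (N (h \<delta>)) b)"
    \<comment> \<open>Subtracting the components of the pair recovers \<open>\<delta>\<close>, hence
      \<open>h \<delta>\<close>; the first component then gives \<open>b\<close>.\<close>
    show "inj_on ?\<phi> P"
    proof (rule inj_onI)
      fix p q assume p: "p \<in> P" and q: "q \<in> P" and "?\<phi> p = ?\<phi> q"
      moreover obtain \<delta> b \<delta>' b' where pq: "p = (\<delta>, b)" "q = (\<delta>', b')" by (cases p, cases q)
      ultimately have eq: "tadd d (h \<delta>) b = tadd d (h \<delta>') b'" "tadd d (N (h \<delta>)) b = tadd d (N (h \<delta>')) b'"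
        by auto
      have mem: "\<delta> \<in> D" "\<delta>' \<in> D" "b \<in> torus d" "b' \<in> torus d"
        using p q pq B by (auto simp: P_def)
      have "\<delta> = tsub d (tadd d (N (h \<delta>)) b) (tadd d (h \<delta>) b)"
        unfolding tsub_tadd_cancel h(2)[OF mem(1)] ..
      also have "\<dots> = \<delta>'"
        unfolding eq tsub_tadd_cancel h(2)[OF mem(2)] ..
      finally have "\<delta> = \<delta>'" .
      moreover from this have "b = b'"
        using tadd_left_cancel[OF mem(3,4)] eq(1) by simp
      ultimately show "p = q" using pq by simp
    qed
    show "?\<phi> ` P \<subseteq> (SIGMA u:S. V u)"
    proof (rule image_subsetI)
      fix p assume "p \<in> P"
      moreover obtain \<delta> b where p: "p = (\<delta>, b)" by (cases p)
      ultimately have *: "\<delta> \<in> D" "b \<in> B" "c (h \<delta>) b \<le> k" by (auto simp: P_def)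
      then have hA: "h \<delta> \<in> A" using h A'_sub by blast
      have "tadd d (N (h \<delta>)) b \<in> V (tadd d (h \<delta>) b)"
        using * in_S[OF N[OF hA]] unfolding V_def c_def r_def by (simp add: tsub_tadd_cancel)
      then show "?\<phi> p \<in> (SIGMA u:S. V u)"
        using in_S[OF hA *(2)] by (simp add: p)
    qed
    show "finite (SIGMA u:S. V u)" using finS by (simp add: V_def)
  qed
  also have "real (card (SIGMA u:S. V u)) = (\<Sum>u\<in>S. real (card (V u)))"
    using finS by (subst card_SigmaI) (auto simp: V_def)
  also have "\<dots> \<le> (\<Sum>u\<in>S. k)"
    unfolding V_def using finS T pos by (intro sum_mono card_few_closer_le) (auto simp: k_def)
  also have "\<dots> = s * k" by (simp add: s_def)
  finally have "real (card D) \<le> 2 * (s * k) / \<beta>"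
    using pos by (simp add: field_simps)
  also have "\<dots> = 4 * \<kappa> / \<epsilon> * (s ^ 2 / (n * \<beta>))"
    using pos \<epsilon> by (simp add: k_def T_def power2_eq_square field_simps)
  finally show ?thesis
    using A'_sub A'_card unfolding D_def s_def n_def \<beta>_def S_def by blast
qed

section \<open>Choice of the set \<open>B\<close> and the final estimate\<close>

lemma card_le_card_tsumset:
  assumes "finite A" "finite B" "B \<subseteq> torus d" "A \<noteq> {}"
  shows "card B \<le> card (tsumset d A B)"
proof -
  obtain a where "a \<in> A" using assms by blast
  show ?thesis
  proof (rule card_inj_on_le)
    show "inj_on (tadd d a) B" using tadd_left_cancel assms by (meson inj_onI subsetD)
    show "tadd d a ` B \<subseteq> tsumset d A B" using \<open>a \<in> A\<close> by (auto simp: tsumset_def)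
    show "finite (tsumset d A B)" using assms by (simp add: tsumset_finite)
  qed
qed

lemma tsumset_commute: "tsumset d A B = tsumset d B A"
  unfolding tsumset_def using tadd_commute by blast

text \<open>The sumset contains translates of \<open>A\<close> and of \<open>B\<close>. The bound
  makes the infimum over \<open>B\<close> positive, so that some \<open>B\<close> comes within a
  factor 2 of it.\<close>

lemma doubling_ge_1:
  assumes "finite A" "finite B" "A \<subseteq> torus d" "B \<subseteq> torus d" "A \<noteq> {}" "B \<noteq> {}"
  shows "real (card (tsumset d A B)) ^ 2 / (real (card A) * real (card B)) \<ge> 1"
proof -
  have "card B \<le> card (tsumset d A B)" using assms by (intro card_le_card_tsumset)
  moreover have "card A \<le> card (tsumset d A B)"
    unfolding tsumset_commute[of d A B] using assms by (intro card_le_card_tsumset)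
  ultimately have "real (card A) * real (card B) \<le> real (card (tsumset d A B)) ^ 2"
    unfolding power2_eq_square by (intro mult_mono) auto
  moreover have "real (card A) * real (card B) > 0" using assms by (simp add: card_gt_0_iff)
  ultimately show ?thesis by (simp add: le_divide_eq)
qed

theorem theorem4:
  shows "\<exists>K::real. \<exists>\<epsilon>\<^sub>0::real. K > 0 \<and> 0 < \<epsilon>\<^sub>0 \<and> \<epsilon>\<^sub>0 < 1 \<and>
    (\<forall>(d::nat) (A::(nat \<Rightarrow> real) set) (\<epsilon>::real) (N::(nat \<Rightarrow> real) \<Rightarrow> (nat \<Rightarrow> real)).
       d \<ge> 1 \<longrightarrow> A \<subseteq> torus d \<longrightarrow> finite A \<longrightarrow> card A \<ge> 2 \<longrightarrow>
       0 < \<epsilon> \<longrightarrow> \<epsilon> \<le> \<epsilon>\<^sub>0 \<longrightarrow>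
       (\<forall>a\<in>A. N a \<in> A - {a} \<and>
          (\<forall>b\<in>A - {a}. tnorm d (tsub d (N a) a) \<le> tnorm d (tsub d b a))) \<longrightarrow>
       (\<exists>A'. A' \<subseteq> A \<and> real (card A') \<ge> (1 - \<epsilon>) * real (card A) \<and>
          (\<forall>B. B \<subseteq> torus d \<longrightarrow> finite B \<longrightarrow> B \<noteq> {} \<longrightarrow>
             real (card ((\<lambda>a. tsub d (N a) a) ` A')) \<le>
               K * (4/3) ^ d * (real (card (tsumset d A B)) ^ 2 / (real (card A) * real (card B)))
                 * (1 / \<epsilon>) * ln (1 / \<epsilon>))))"
proof -
  obtain C :: real where C: "C > 0"
    "\<And>d X. \<lbrakk>finite X; \<And>x i. x \<in> X \<Longrightarrow> i \<ge> d \<Longrightarrow> x i = 0; \<And>x. x \<in> X \<Longrightarrow> dot d x x = 1;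
       \<And>x y. x \<in> X \<Longrightarrow> y \<in> X \<Longrightarrow> x \<noteq> y \<Longrightarrow> dot d x y \<le> 1/2\<rbrakk>
      \<Longrightarrow> real (card X) \<le> C * (4/3) ^ d"
    using kissing_number_bound by blast
  show ?thesis
  \<comment> \<open>The 8 is the 4 of \<open>few_nearest_differences\<close> times 2 for the nearly
    optimal \<open>B\<close>, and \<open>C + 1\<close> absorbs the extra 1 in
    \<open>\<kappa>\<close>. Since \<open>exp 1 \<le> 3\<close>, the bound 1/3 on
    \<open>\<epsilon>\<close> gives \<open>ln (1 / \<epsilon>) \<ge> 1\<close>.\<close>
  proof (rule exI[of _ "8 * (C + 1)"], rule exI[of _ "1/3"], intro conjI allI impI)
    show "0 < 8 * (C + 1)" using C by simp
    fix d A N and \<epsilon> :: real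
    assume A: "A \<subseteq> torus d" "finite A" "card A \<ge> 2" and \<epsilon>: "0 < \<epsilon>" "\<epsilon> \<le> 1/3"
      and N: "\<forall>a\<in>A. N a \<in> A - {a} \<and>
          (\<forall>b\<in>A - {a}. tnorm d (tsub d (N a) a) \<le> tnorm d (tsub d b a))"
    define \<kappa> where "\<kappa> = C * (4/3) ^ d + 1"
    have \<kappa>: "\<kappa> > 0" "\<kappa> \<le> (C + 1) * (4/3) ^ d"
      using C(1) one_le_power[of "4/3 :: real" d] by (auto simp: \<kappa>_def algebra_simps intro: add_pos_pos)
    have ne: "A \<noteq> {}" using A by auto
    \<comment> \<open>\<open>A'\<close> has to be chosen before \<open>B\<close>, so it is chosen for a nearly optimal \<open>B\<close>.\<close>
    define \<rho> where "\<rho> = (\<lambda>B. real (card (tsumset d A B)) ^ 2 / (real (card A) * real (card B)))"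
    define \<B> where "\<B> = {B. B \<subseteq> torus d \<and> finite B \<and> B \<noteq> {}}"
    have ge1: "\<rho> B \<ge> 1" if "B \<in> \<B>" for B
      unfolding \<rho>_def by (rule doubling_ge_1) (use that A ne in \<open>auto simp: \<B>_def\<close>)
    have bdd: "bdd_below (\<rho> ` \<B>)" using ge1 by (intro bdd_belowI[of _ 1]) auto
    have "\<B> \<noteq> {}" using A ne by (auto simp: \<B>_def)
    then have "Inf (\<rho> ` \<B>) \<ge> 1" using ge1 by (intro cInf_greatest) auto
    then have "Inf (\<rho> ` \<B>) < 2 * Inf (\<rho> ` \<B>)" by simp
    with \<open>\<B> \<noteq> {}\<close> have "\<exists>y\<in>\<rho> ` \<B>. y < 2 * Inf (\<rho> ` \<B>)"
      by (intro cInf_lessD) auto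
    then obtain B where B: "B \<in> \<B>" "\<rho> B < 2 * Inf (\<rho> ` \<B>)"
      by blast
    have "\<exists>A'\<subseteq>A. real (card A') \<ge> (1 - \<epsilon>) * real (card A) \<and>
        real (card ((\<lambda>a. tsub d (N a) a) ` A')) \<le> 4 * \<kappa> / \<epsilon> * \<rho> B"
      unfolding \<rho>_def
    proof (rule few_nearest_differences)
      fix x A' assume *: "A' \<subseteq> A" "x \<in> torus d"
        "\<And>a. a \<in> A' \<Longrightarrow> tnorm d (tsub d a x) \<le> tnorm d (tsub d (N a) a)"
      show "real (card A') \<le> \<kappa>"
        unfolding \<kappa>_def
      proof (rule nearest_ball_overlap[where r = "\<lambda>a. tnorm d (tsub d (N a) a)"])
        show "finite A'" using * A finite_subset by blast
        show "A' \<subseteq> torus d" using * A by blast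
        show "tnorm d (tsub d (N a) a) \<le> tnorm d (tsub d b a)" if "a \<in> A'" "b \<in> A'" "a \<noteq> b" for a b
          using N that *(1) by blast
      qed (use C(2) * in blast)+
    qed (use A ne \<epsilon> N B \<kappa> in \<open>auto simp: \<B>_def\<close>)
    then obtain A' where A': "A' \<subseteq> A" "real (card A') \<ge> (1 - \<epsilon>) * real (card A)"
        "real (card ((\<lambda>a. tsub d (N a) a) ` A')) \<le> 4 * \<kappa> / \<epsilon> * \<rho> B"
      by blast
    have "exp 1 * \<epsilon> \<le> 3 * \<epsilon>"
      by (rule mult_right_mono[OF exp_le]) (use \<epsilon> in simp)
    then have "exp 1 \<le> 1 / \<epsilon>"
      unfolding pos_le_divide_eq[OF \<epsilon>(1)] using \<epsilon>(2) by linarith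
    then have ln1: "1 \<le> ln (1 / \<epsilon>)" using \<epsilon> by (simp add: ln_ge_iff)
    show "\<exists>A'. A' \<subseteq> A \<and> real (card A') \<ge> (1 - \<epsilon>) * real (card A) \<and>
          (\<forall>B. B \<subseteq> torus d \<longrightarrow> finite B \<longrightarrow> B \<noteq> {} \<longrightarrow>
             real (card ((\<lambda>a. tsub d (N a) a) ` A')) \<le>
               8 * (C + 1) * (4/3) ^ d * (real (card (tsumset d A B)) ^ 2 / (real (card A) * real (card B)))
                 * (1 / \<epsilon>) * ln (1 / \<epsilon>))"
    proof (intro exI[of _ A'] conjI allI impI)
      fix B' assume "B' \<subseteq> torus d" "finite B'" "B' \<noteq> {}"
      then have B': "B' \<in> \<B>" by (simp add: \<B>_def)
      have "\<rho> B \<le> 2 * \<rho> B'"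
        using B(2) cInf_lower[OF imageI[OF B'] bdd] by simp
      then have "4 * \<kappa> / \<epsilon> * \<rho> B \<le> 4 * ((C + 1) * (4/3) ^ d) / \<epsilon> * (2 * \<rho> B')"
        using \<kappa> \<epsilon> ge1[OF B(1)] by (intro mult_mono divide_right_mono) auto
      also have "\<dots> = 8 * (C + 1) * (4/3) ^ d * \<rho> B' * (1 / \<epsilon>) * 1" by simp
      also have "\<dots> \<le> 8 * (C + 1) * (4/3) ^ d * \<rho> B' * (1 / \<epsilon>) * ln (1 / \<epsilon>)"
        using ln1 C(1) \<epsilon> ge1[OF B'] by (intro mult_left_mono) auto
      finally show "real (card ((\<lambda>a. tsub d (N a) a) ` A')) \<le>
          8 * (C + 1) * (4/3) ^ d * (real (card (tsumset d A B')) ^ 2 / (real (card A) * real (card B')))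
            * (1 / \<epsilon>) * ln (1 / \<epsilon>)"
        using A'(3) unfolding \<rho>_def by linarith
    qed (use A' in auto)
  qed auto
qed

end
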